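(* Consider an unreplicated completely randomized design ($N_q=1$ for all $q$, $Q=N$) with $S(q,q)>0$ for all $q$, a grouping $\{\langle g\rangle\}$, the diagonal matrix $\hat V_{\hat Y}=\mathrm{diag}(\hat V_{\hat Y}(q,q))_{q\in[Q]}$, and $\hat V_{\hat\gamma}=F^\top\hat V_{\hat Y}F$ for a fixed $F\in\mathbb R^{Q\times H}$. (i) Under Condition 5, $$\mathbb E\{\hat V_{\hat Y}\}=V_{\hat Y}+\Omega+\mathrm{diag}\big(\mu_{\langle g\rangle_q}(\overline Y(q)-\overline Y_{\langle g\rangle_q})^2\big)_{q\in[Q]}+N^{-1}(\Theta+S),$$ where $\Omega=\mathrm{diag}(\Omega(q,q))$ with $\Omega(q,q)$ as defined below, and $\Theta=\mathrm{diag}(\Theta(q,q))$ is a diagonal matrix with $0\le\Theta(q,q)\le5\mu_{\langle g\rangle_q}\max_{q'\in\langle g\rangle_q}S(q',q')$. Consequently $\mathbb E\{F^\top\hat V_{\hat Y}F\}\succeq V_{\hat\gamma}$. (ii)--(iii) For a sequence of such designs indexed by $N$ satisfying Conditions 3 and 6, $$\|\hat V_{\hat\gamma}-\mathbb E\hat V_{\hat\gamma}\|_\infty^2=O_{\mathbb P}\big\{(\max_g\mu_{\langle g\rangle})^2\|F\|_\infty^4\Delta^2(\Delta^2+\zeta^2)NH^2\big\},$$ $$\|\hat V_{\hat\gamma}-\mathbb E\hat V_{\hat\gamma}\|_{\mathrm{op}}^2=O_{\mathbb P}\big\{(\max_g\mu_{\langle g\rangle})^2\|F\|_\infty^4\D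elta^2(\Delta^2+\zeta^2)NH^4\big\}.$$
   Context: Randomization model with $N$ units and $Q$ treatment levels; unit $i$ has fixed real potential outcomes $Y_i(1),\dots,Y_i(Q)$. Unreplicated complete randomization: $N_q=1$ for all $q$ and the assignment is a uniformly random bijection between units and levels; $Y_q$ denotes the observed outcome of the unit assigned to level $q$. $\overline Y(q)=N^{-1}\sum_iY_i(q)$, $S(q,q')=(N-1)^{-1}\sum_i(Y_i(q)-\overline Y(q))(Y_i(q')-\overline Y(q'))$, $S=(S(q,q'))$, $S^\star(q,q')=S(q,q')/\sqrt{S(q,q)S(q',q')}$, $V_{\hat Y}=\mathrm{diag}(S(q,q))-N^{-1}S$, $V_{\hat\gamma}=F^\top V_{\hat Y}F$. $\|A\|_\infty$ = max absolute entry, $\|A\|_{\mathrm{op}}$ = spectral norm. Grouping: a fixed (data-independent) partition $[Q]=\bigcup_{g=1}^G\langle g\rangle$ into disjoint groups with $|\langle g\rangle|\ge2$; $\langle g\rangle_q$ is the group containing $q$. $\hat Y_{\langle g\rangle}=|\langle g\rangle|^{-1}\sum_{q\in\langle g\rangle}Y_q$, $\overline Y_{\langle g\rangle}=|\langle g\rangle|^{-1}\sum_{q\in\langle g\rangle}\overline Y(q)$, $\mu_{\langle g\rangle}=(1-2N^{-1})^{-1}(1-|\langle g\rangle|^{-1})^{-2}$, $\hat V_{\hat Y}(q,q)=\mu_{\langle g\rangle_q}(Y_q-\hat Y_{\langle g\rangle_q})^2$. $\varrho_{\langle g\rangle}$ is the largest eigenvalue of $(S^\star(q,q'))_{q,q'\in\langle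 g\rangle}$, and for $q\in\langle g\rangle$, $\Omega(q,q)=\mu_{\langle g\rangle}|\langle g\rangle|^{-2}(1-\varrho_{\langle g\rangle}/N-(|\langle g\rangle|-1)/N)\sum_{q'\in\langle g\rangle,q'\ne q}S(q',q')$. Condition 3: $\max_qN^{-1}\sum_i\{Y_i(q)-\overline Y(q)\}^4\le\Delta^4$. Condition 5: $N-\varrho_{\langle g\rangle}-(|\langle g\rangle|-1)\ge0$ for all groups. Condition 6: $\max_g\max_{q\in\langle g\rangle}|\overline Y(q)-\overline Y_{\langle g\rangle}|\le\zeta$. *)

theory Defs
  imports "HOL-Analysis.Analysis"
begin

text \<open>Conventions. Units and treatment levels are both indexed by {..<N} (Q = N).
  Potential outcomes: Y i q = Y_i(q). Matrices are functions nat => nat => real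
  with explicit index ranges. The assignment is a permutation sigma of {..<N}:
  level q receives unit sigma q, drawn uniformly among all N! permutations.\<close>

definition perms :: "nat \<Rightarrow> (nat \<Rightarrow> nat) set" where
  "perms N = {\<sigma>. \<sigma> permutes {..<N}}"

definition Eperm :: "nat \<Rightarrow> ((nat \<Rightarrow> nat) \<Rightarrow> real) \<Rightarrow> real" where
  "Eperm N f = (\<Sum>\<sigma>\<in>perms N. f \<sigma>) / fact N"

definition Pperm :: "nat \<Rightarrow> ((nat \<Rightarrow> nat) \<Rightarrow> bool) \<Rightarrow> real" where
  "Pperm N A = real (card {\<sigma>\<in>perms N. A \<sigma>}) / fact N"

definition Ybar :: "(nat \<Rightarrow> nat \<Rightarrow> real) \<Rightarrow> nat \<Rightarrow> nat \<Rightarrow> real" where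
  "Ybar Y N q = (\<Sum>i<N. Y i q) / real N"

definition Scov :: "(nat \<Rightarrow> nat \<Rightarrow> real) \<Rightarrow> nat \<Rightarrow> nat \<Rightarrow> nat \<Rightarrow> real" where
  "Scov Y N q q' = (\<Sum>i<N. (Y i q - Ybar Y N q) * (Y i q' - Ybar Y N q')) / (real N - 1)"

definition Scor :: "(nat \<Rightarrow> nat \<Rightarrow> real) \<Rightarrow> nat \<Rightarrow> nat \<Rightarrow> nat \<Rightarrow> real" where
  "Scor Y N q q' = Scov Y N q q' / sqrt (Scov Y N q q * Scov Y N q' q')"

definition VY :: "(nat \<Rightarrow> nat \<Rightarrow> real) \<Rightarrow> nat \<Rightarrow> nat \<Rightarrow> nat \<Rightarrow> real" where
  "VY Y N q q' = (if q = q' then Scov Y N q q else 0) - Scov Y N q q' / real N"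

definition sandwich :: "nat \<Rightarrow> (nat \<Rightarrow> nat \<Rightarrow> real) \<Rightarrow> (nat \<Rightarrow> nat \<Rightarrow> real) \<Rightarrow> nat \<Rightarrow> nat \<Rightarrow> real" where
  "sandwich Q F A h h' = (\<Sum>q<Q. \<Sum>q'<Q. F q h * A q q' * F q' h')"

definition Vgamma :: "(nat \<Rightarrow> nat \<Rightarrow> real) \<Rightarrow> (nat \<Rightarrow> nat \<Rightarrow> real) \<Rightarrow> nat \<Rightarrow> nat \<Rightarrow> nat \<Rightarrow> real" where
  "Vgamma F Y N = sandwich N F (VY Y N)"

definition is_grouping :: "nat \<Rightarrow> nat set set \<Rightarrow> bool" where
  "is_grouping N P \<longleftrightarrow> \<Union>P = {..<N} \<and> (\<forall>B\<in>P. card B \<ge> 2)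
     \<and> (\<forall>A\<in>P. \<forall>B\<in>P. A \<noteq> B \<longrightarrow> A \<inter> B = {})"

definition grp :: "nat set set \<Rightarrow> nat \<Rightarrow> nat set" where
  "grp P q = (THE B. B \<in> P \<and> q \<in> B)"

definition mu :: "nat \<Rightarrow> nat set \<Rightarrow> real" where
  "mu N B = inverse (1 - 2 / real N) * inverse ((1 - 1 / real (card B))^2)"

definition Yobs :: "(nat \<Rightarrow> nat \<Rightarrow> real) \<Rightarrow> (nat \<Rightarrow> nat) \<Rightarrow> nat \<Rightarrow> real" where
  "Yobs Y \<sigma> q = Y (\<sigma> q) q"

definition Yhat_grp :: "(nat \<Rightarrow> nat \<Rightarrow> real) \<Rightarrow> (nat \<Rightarrow> nat) \<Rightarrow> nat set \<Rightarrow> real" where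
  "Yhat_grp Y \<sigma> B = (\<Sum>q\<in>B. Yobs Y \<sigma> q) / real (card B)"

definition Ybar_grp :: "(nat \<Rightarrow> nat \<Rightarrow> real) \<Rightarrow> nat \<Rightarrow> nat set \<Rightarrow> real" where
  "Ybar_grp Y N B = (\<Sum>q\<in>B. Ybar Y N q) / real (card B)"

definition Vhat :: "nat set set \<Rightarrow> (nat \<Rightarrow> nat \<Rightarrow> real) \<Rightarrow> nat \<Rightarrow> (nat \<Rightarrow> nat) \<Rightarrow> nat \<Rightarrow> nat \<Rightarrow> real" where
  "Vhat P Y N \<sigma> q q' = (if q = q' then mu N (grp P q) * (Yobs Y \<sigma> q - Yhat_grp Y \<sigma> (grp P q))^2 else 0)"

definition largest_eig :: "(nat \<Rightarrow> nat \<Rightarrow> real) \<Rightarrow> nat set \<Rightarrow> real" where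
  "largest_eig A B = Max {l. \<exists>v. (\<exists>q\<in>B. v q \<noteq> 0) \<and> (\<forall>q\<in>B. (\<Sum>q'\<in>B. A q q' * v q') = l * v q)}"

definition rho :: "(nat \<Rightarrow> nat \<Rightarrow> real) \<Rightarrow> nat \<Rightarrow> nat set \<Rightarrow> real" where
  "rho Y N B = largest_eig (Scor Y N) B"

definition Omega :: "nat set set \<Rightarrow> (nat \<Rightarrow> nat \<Rightarrow> real) \<Rightarrow> nat \<Rightarrow> nat \<Rightarrow> real" where
  "Omega P Y N q = (let B = grp P q in
     mu N B / (real (card B))^2 * (1 - rho Y N B / real N - (real (card B) - 1) / real N)
       * (\<Sum>q'\<in>B - {q}. Scov Y N q' q'))"

definition condition3 :: "(nat \<Rightarrow> nat \<Rightarrow> real) \<Rightarrow> nat \<Rightarrow> real \<Rightarrow> bool" where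
  "condition3 Y N \<Delta> \<longleftrightarrow> (\<forall>q<N. (\<Sum>i<N. (Y i q - Ybar Y N q)^4) / real N \<le> \<Delta>^4)"

definition condition5 :: "nat set set \<Rightarrow> (nat \<Rightarrow> nat \<Rightarrow> real) \<Rightarrow> nat \<Rightarrow> bool" where
  "condition5 P Y N \<longleftrightarrow> (\<forall>B\<in>P. real N - rho Y N B - (real (card B) - 1) \<ge> 0)"

definition condition6 :: "nat set set \<Rightarrow> (nat \<Rightarrow> nat \<Rightarrow> real) \<Rightarrow> nat \<Rightarrow> real \<Rightarrow> bool" where
  "condition6 P Y N \<zeta> \<longleftrightarrow> (\<forall>B\<in>P. \<forall>q\<in>B. \<bar>Ybar Y N q - Ybar_grp Y N B\<bar> \<le> \<zeta>)"

definition psd :: "nat \<Rightarrow> (nat \<Rightarrow> nat \<Rightarrow> real) \<Rightarrow> bool" where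
  "psd n A \<longleftrightarrow> (\<forall>x::nat \<Rightarrow> real. (\<Sum>i<n. \<Sum>j<n. x i * A i j * x j) \<ge> 0)"

definition maxnorm :: "nat \<Rightarrow> nat \<Rightarrow> (nat \<Rightarrow> nat \<Rightarrow> real) \<Rightarrow> real" where
  "maxnorm m n A = Max (insert 0 {\<bar>A i j\<bar> | i j. i < m \<and> j < n})"

definition opnorm :: "nat \<Rightarrow> nat \<Rightarrow> (nat \<Rightarrow> nat \<Rightarrow> real) \<Rightarrow> real" where
  "opnorm m n A = Sup (insert 0 {sqrt (\<Sum>i<m. (\<Sum>j<n. A i j * x j)^2) | x.
        (\<Sum>j<n. (x j)^2) = 1})"

definition bigOP :: "(nat \<Rightarrow> (nat \<Rightarrow> nat) \<Rightarrow> real) \<Rightarrow> (nat \<Rightarrow> real) \<Rightarrow> bool" where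
  "bigOP X a \<longleftrightarrow> (\<forall>\<epsilon>>0. \<exists>M>0. \<exists>N0. \<forall>N\<ge>N0. Pperm N (\<lambda>\<sigma>. \<bar>X N \<sigma>\<bar> > M * a N) \<le> \<epsilon>)"

end

theory Submission
  imports Defs
begin

text \<open>
  Write \<open>a\<^sub>q\<close> for the observed outcome of level \<open>q\<close> centred at its mean. The residual of \<open>q\<close> in its group
  \<open>B\<close> is its bias plus a linear combination of the \<open>a\<^sub>r\<close> with \<open>r \<in> B\<close>, whose covariance matrix is \<open>VY\<close>.
  With \<open>b = |B|\<close>, expanding the second moment leaves
  \<open>\<Theta>(q,q) = \<mu> b\<^sup>-\<^sup>2 ((b - 1) \<Sum>\<^sub>r (S(q,q) + 2 S(q,r) + S(r,r)) + \<rho> \<Sum>\<^sub>r S(r,r) - \<Sum>\<^sub>r\<^sub>,\<^sub>s S(r,s))\<close>, the sums running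
  over \<open>B - {q}\<close>. The first part is nonnegative because \<open>S\<close> is positive semidefinite, the second because
  \<open>\<rho>\<close> is the maximum of the Rayleigh quotient of the correlation matrix.

  For the stochastic bounds, each entry of the deviation has variance at most \<open>N V\<close>, where \<open>V\<close> bounds
  the mean square change of the statistic when two levels exchange their units. This
  Efron-Stein inequality for permutations follows by averaging over larger and larger subgroups
  of permutations, one position at a time. An exchange amounts to two changes of a single outcome, each of
  which affects one group only, and fourth moments give
  \<open>V = O(K\<^sup>2 \<Delta>\<^sup>2 (\<Delta>\<^sup>2 + \<zeta>\<^sup>2))\<close> with \<open>K = max \<mu> \<parallel>F\<parallel>\<^sup>2\<close>. Both norms are dominated by the
  Frobenius norm, and Markov's inequality concludes.
\<close>

subsection \<open>Eigenvalues of symmetric matrices\<close>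

definition quad_form :: "(nat \<Rightarrow> nat \<Rightarrow> real) \<Rightarrow> nat set \<Rightarrow> (nat \<Rightarrow> real) \<Rightarrow> real" where
  "quad_form A B x = (\<Sum>i\<in>B. \<Sum>j\<in>B. x i * A i j * x j)"

text \<open>The set inside \<open>largest_eig\<close>, named because its \<open>Max\<close> is
  meaningful only once the set is known to be finite and nonempty.\<close>

definition eigenvalues_on :: "(nat \<Rightarrow> nat \<Rightarrow> real) \<Rightarrow> nat set \<Rightarrow> real set" where
  "eigenvalues_on A B =
     {l. \<exists>v. (\<exists>q\<in>B. v q \<noteq> 0) \<and> (\<forall>q\<in>B. (\<Sum>q'\<in>B. A q q' * v q') = l * v q)}"

lemma quad_form_alt: "quad_form A B x = (\<Sum>i\<in>B. x i * (\<Sum>j\<in>B. A i j * x j))"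
  unfolding quad_form_def by (simp add: sum_distrib_left mult.assoc)

lemma bilinear_symmetric:
  assumes "\<forall>i\<in>B. \<forall>j\<in>B. A i j = (A j i :: real)"
  shows "(\<Sum>i\<in>B. x i * (\<Sum>j\<in>B. A i j * y j)) = (\<Sum>i\<in>B. y i * (\<Sum>j\<in>B. A i j * x j))"
proof -
  have "(\<Sum>i\<in>B. x i * (\<Sum>j\<in>B. A i j * y j)) = (\<Sum>i\<in>B. \<Sum>j\<in>B. x i * A i j * y j)"
    by (simp add: sum_distrib_left mult.assoc)
  also have "\<dots> = (\<Sum>j\<in>B. \<Sum>i\<in>B. x i * A i j * y j)"
    by (rule sum.swap)
  also have "\<dots> = (\<Sum>i\<in>B. y i * (\<Sum>j\<in>B. A i j * x j))"
    unfolding sum_distrib_left by (intro sum.cong refl) (use assms in \<open>simp add: mult_ac\<close>)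
  finally show ?thesis .
qed

lemma quad_form_add:
  assumes "\<forall>i\<in>B. \<forall>j\<in>B. A i j = A j i"
  shows "quad_form A B (\<lambda>i. x i + t * y i) =
    quad_form A B x + 2 * t * (\<Sum>i\<in>B. y i * (\<Sum>j\<in>B. A i j * x j)) + t^2 * quad_form A B y"
proof -
  have "quad_form A B (\<lambda>i. x i + t * y i) =
     quad_form A B x + t * (\<Sum>i\<in>B. x i * (\<Sum>j\<in>B. A i j * y j))
     + t * (\<Sum>i\<in>B. y i * (\<Sum>j\<in>B. A i j * x j)) + t^2 * quad_form A B y"
    unfolding quad_form_alt
    by (simp add: algebra_simps sum.distrib sum_distrib_left power2_eq_square)
  then show ?thesis
    using bilinear_symmetric[OF assms, where x = x and y = y] by simp
qed

text \<open>First-order optimality: for small \<open>t\<close> the linear side dominates the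
  quadratic one, so a nonzero slope would break the bound for some \<open>t\<close> of the same sign
  as \<open>s\<close>.\<close>

lemma eq_0_of_linear_le_quadratic:
  fixes s c :: real
  assumes "\<And>t. 2 * t * s \<le> t^2 * c"
  shows "s = 0"
proof (rule ccontr)
  assume "s \<noteq> 0"
  have pos: "\<bar>c\<bar> + 1 > 0" by simp
  \<comment> \<open>This choice makes \<open>t^2 * (\<bar>c\<bar> + 1)\<close> equal to
    \<open>t * s\<close>, half of the linear side; the added 1 keeps the denominator positive when
    \<open>c = 0\<close>.\<close>
  define t where "t = s / (\<bar>c\<bar> + 1)"
  have "t^2 * c \<le> t^2 * (\<bar>c\<bar> + 1)" by (intro mult_left_mono) auto
  also have "\<dots> = t * s" unfolding t_def using pos by (simp add: power2_eq_square)
  finally have "2 * t * s \<le> t * s" using assms[of t] by linarith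
  moreover have "t * s > 0"
    unfolding t_def using pos \<open>s \<noteq> 0\<close> by (auto simp: power2_eq_square[symmetric] intro!: divide_pos_pos)
  ultimately show False by linarith
qed

text \<open>Vectors are functions on all naturals, so coordinates outside \<open>B\<close> are
  pinned to 0. The sphere is then a closed subset of a product of intervals and singletons, which is
  compact by Tychonoff's theorem.\<close>

lemma compact_unit_sphere_on:
  assumes "finite B"
  shows "compact {v :: nat \<Rightarrow> real. (\<forall>i. i \<notin> B \<longrightarrow> v i = 0) \<and> (\<Sum>i\<in>B. (v i)^2) = 1}"
    (is "compact ?K")
proof -
  let ?box = "PiE UNIV (\<lambda>i. if i \<in> B then {-1..1::real} else {0})"
  have "compactin (product_topology (\<lambda>_. euclidean) UNIV) ?box"
    by (subst compactin_PiE) auto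
  then have box: "compact ?box"
    by (simp add: euclidean_product_topology flip: compactin_euclidean_iff)
  have cont: "continuous_on UNIV (\<lambda>v :: nat \<Rightarrow> real. \<Sum>i\<in>B. (v i)^2)"
    by (intro continuous_intros continuous_on_product_coordinates)
  have "closed {v :: nat \<Rightarrow> real. (\<Sum>i\<in>B. (v i)^2) = 1}"
    by (intro closed_Collect_eq cont continuous_intros)
  then have "compact (?box \<inter> {v. (\<Sum>i\<in>B. (v i)^2) = 1})"
    using box by (rule compact_Int_closed[rotated])
  also have "?box \<inter> {v. (\<Sum>i\<in>B. (v i)^2) = 1} = ?K"
  proof (intro equalityI subsetI)
    fix v assume v: "v \<in> ?K"
    have "v i \<in> {-1..1}" if "i \<in> B" for i
    proof -
      have "(v i)^2 \<le> (\<Sum>i\<in>B. (v i)^2)"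
        using that assms by (intro member_le_sum) auto
      then have "(v i)^2 \<le> 1" using v by simp
      then show ?thesis by (simp add: abs_square_le_1 abs_le_iff)
    qed
    then show "v \<in> ?box \<inter> {v. (\<Sum>i\<in>B. (v i)^2) = 1}" using v by auto
  next
    fix v assume "v \<in> ?box \<inter> {v. (\<Sum>i\<in>B. (v i)^2) = 1}"
    then show "v \<in> ?K" by (auto simp: PiE_iff split: if_splits)
  qed
  finally show ?thesis .
qed

text \<open>The quadratic form attains its maximum \<open>l\<close> on the unit sphere, and
  homogeneity extends the bound to all vectors. A maximiser \<open>v\<close> is an eigenvector:
  otherwise moving it along the residual \<open>A v - l v\<close> would raise the Rayleigh
  quotient.\<close>

lemma rayleigh_eigenvalue:
  assumes fin: "finite B" and ne: "B \<noteq> {}"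
    and sym: "\<forall>i\<in>B. \<forall>j\<in>B. A i j = A j i"
  obtains l where "l \<in> eigenvalues_on A B" and "\<And>x. quad_form A B x \<le> l * (\<Sum>i\<in>B. (x i)^2)"
proof -
  let ?K = "{v :: nat \<Rightarrow> real. (\<forall>i. i \<notin> B \<longrightarrow> v i = 0) \<and> (\<Sum>i\<in>B. (v i)^2) = 1}"
  obtain b where "b \<in> B" using ne by auto
  have "(\<lambda>i. if i = b then 1 else 0) \<in> ?K"
    using \<open>b \<in> B\<close> fin by (auto simp: if_distrib[of "\<lambda>x. x^2"] sum.delta cong: if_cong)
  then have Kne: "?K \<noteq> {}" by (metis empty_iff)
  have cont: "continuous_on ?K (quad_form A B)"
    unfolding quad_form_def
    by (intro continuous_intros continuous_on_subset[OF continuous_on_product_coordinates subset_UNIV])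
  obtain v where v: "v \<in> ?K" and vmax: "\<And>w. w \<in> ?K \<Longrightarrow> quad_form A B w \<le> quad_form A B v"
    using continuous_attains_sup[OF compact_unit_sphere_on[OF fin] Kne cont] by auto
  define l where "l = quad_form A B v"
  have max: "quad_form A B x \<le> l * (\<Sum>i\<in>B. (x i)^2)" for x
  proof (cases "(\<Sum>i\<in>B. (x i)^2) = 0")
    case True
    then have "\<forall>i\<in>B. x i = 0" using fin by (simp add: sum_nonneg_eq_0_iff)
    then show ?thesis by (simp add: quad_form_def)
  next
    case False
    define n where "n = sqrt (\<Sum>i\<in>B. (x i)^2)"
    have n: "n > 0" "n^2 = (\<Sum>i\<in>B. (x i)^2)"
      using False sum_nonneg[of B "\<lambda>i. (x i)^2"] by (auto simp: n_def less_le)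
    define w where "w i = (if i \<in> B then x i / n else 0)" for i
    have "(\<Sum>i\<in>B. (w i)^2) = (\<Sum>i\<in>B. (x i)^2) / n^2"
      by (simp add: w_def power_divide sum_divide_distrib)
    also have "\<dots> = 1" using False by (simp add: n(2))
    finally have "w \<in> ?K" by (simp add: w_def)
    then have "quad_form A B w \<le> l" unfolding l_def by (rule vmax)
    moreover have "quad_form A B w = quad_form A B x / n^2"
      unfolding quad_form_def sum_divide_distrib
      by (intro sum.cong refl) (simp add: w_def power2_eq_square)
    ultimately have "quad_form A B x \<le> l * n^2" using n(1) by (simp add: field_simps)
    then show ?thesis by (simp add: n(2))
  qed
  define Av where "Av i = (\<Sum>j\<in>B. A i j * v j)" for i
  \<comment> \<open>Along this direction the first-order coefficient of the form minus
    \<open>l\<close> times the squared norm is twice the squared norm of \<open>w\<close>, so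
    optimality forces \<open>w\<close> to vanish on \<open>B\<close>.\<close>
  define w where "w i = Av i - l * v i" for i
  have vn: "(\<Sum>i\<in>B. (v i)^2) = 1" using v by simp
  have "2 * t * (\<Sum>i\<in>B. (w i)^2) \<le> t^2 * (l * (\<Sum>i\<in>B. (w i)^2) - quad_form A B w)" for t
  proof -
    have "l + 2 * t * (\<Sum>i\<in>B. w i * Av i) + t^2 * quad_form A B w
        \<le> l * (\<Sum>i\<in>B. (v i + t * w i)^2)"
      using max[of "\<lambda>i. v i + t * w i"] unfolding quad_form_add[OF sym] l_def Av_def by simp
    also have "(\<Sum>i\<in>B. (v i + t * w i)^2) = 1 + 2 * t * (\<Sum>i\<in>B. w i * v i) + t^2 * (\<Sum>i\<in>B. (w i)^2)"
      unfolding vn[symmetric] by (simp add: power2_sum sum.distrib sum_distrib_left power_mult_distrib mult_ac)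
    finally have "2 * t * ((\<Sum>i\<in>B. w i * Av i) - l * (\<Sum>i\<in>B. w i * v i))
        \<le> t^2 * (l * (\<Sum>i\<in>B. (w i)^2) - quad_form A B w)"
      by (simp add: algebra_simps)
    also have "(\<Sum>i\<in>B. w i * Av i) - l * (\<Sum>i\<in>B. w i * v i) = (\<Sum>i\<in>B. (w i)^2)"
      unfolding sum_distrib_left sum_subtractf[symmetric]
      by (intro sum.cong refl) (simp add: w_def power2_eq_square algebra_simps)
    finally show ?thesis .
  qed
  then have "(\<Sum>i\<in>B. (w i)^2) = 0" by (rule eq_0_of_linear_le_quadratic)
  then have "\<forall>i\<in>B. Av i = l * v i" using fin by (simp add: sum_nonneg_eq_0_iff w_def)
  moreover have "\<exists>q\<in>B. v q \<noteq> 0"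
  proof (rule ccontr)
    assume "\<not> ?thesis"
    then have "(\<Sum>i\<in>B. (v i)^2) = 0" by simp
    then show False using vn by simp
  qed
  ultimately have "l \<in> eigenvalues_on A B"
    unfolding eigenvalues_on_def Av_def by auto
  then show ?thesis using max that by blast
qed

text \<open>A dimension count: normalised eigenvectors of distinct eigenvalues are orthonormal, so
  \<open>card L\<close> is the sum of all their squared coordinates, while Bessel's inequality
  allows each coordinate in \<open>B\<close> a total of at most 1.\<close>

lemma card_eigenvalues_le:
  assumes fin: "finite B"
    and sym: "\<forall>i\<in>B. \<forall>j\<in>B. A i j = A j i"
    and L: "finite L" "L \<subseteq> eigenvalues_on A B"
  shows "card L \<le> card B"
proof -
  have "\<exists>v. (\<Sum>i\<in>B. (v i)^2) = 1 \<and> (\<forall>q\<in>B. (\<Sum>q'\<in>B. A q q' * v q') = l * v q)" if "l \<in> L" for l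
  proof -
    have "l \<in> eigenvalues_on A B" using L that by blast
    then obtain u where u: "\<exists>q\<in>B. u q \<noteq> 0" "\<forall>q\<in>B. (\<Sum>q'\<in>B. A q q' * u q') = l * u q"
      unfolding eigenvalues_on_def by blast
    define n where "n = sqrt (\<Sum>i\<in>B. (u i)^2)"
    have "(\<Sum>i\<in>B. (u i)^2) > 0" using u(1) fin by (metis sum_pos2 zero_le_power2 zero_less_power2)
    then have n: "n > 0" "n^2 = (\<Sum>i\<in>B. (u i)^2)" by (auto simp: n_def)
    have "(\<Sum>i\<in>B. (u i / n)^2) = 1"
      using \<open>(\<Sum>i\<in>B. (u i)^2) > 0\<close> by (simp add: power_divide n(2) flip: sum_divide_distrib)
    moreover have "(\<Sum>q'\<in>B. A q q' * (u q' / n)) = l * (u q / n)" if "q \<in> B" for q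
      using u(2) that by (simp flip: sum_divide_distrib)
    ultimately show ?thesis by (intro exI[of _ "\<lambda>i. u i / n"]) auto
  qed
  then obtain v where nrm: "\<And>l. l \<in> L \<Longrightarrow> (\<Sum>i\<in>B. (v l i)^2) = 1"
    and eig: "\<And>l q. l \<in> L \<Longrightarrow> q \<in> B \<Longrightarrow> (\<Sum>q'\<in>B. A q q' * v l q') = l * v l q"
    by metis
  have orth: "(\<Sum>i\<in>B. v l i * v m i) = (if l = m then 1 else 0)" if lm: "l \<in> L" "m \<in> L" for l m
  proof (cases "l = m")
    case True
    then show ?thesis using nrm lm by (simp add: power2_eq_square)
  next
    case False
    have "(\<Sum>i\<in>B. v l i * (m * v m i)) = (\<Sum>i\<in>B. v l i * (\<Sum>j\<in>B. A i j * v m j))"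
      using eig lm by simp
    also have "\<dots> = (\<Sum>i\<in>B. v m i * (\<Sum>j\<in>B. A i j * v l j))"
      by (rule bilinear_symmetric[OF sym])
    also have "\<dots> = (\<Sum>i\<in>B. v m i * (l * v l i))"
      using eig lm by simp
    finally have "m * (\<Sum>i\<in>B. v l i * v m i) = l * (\<Sum>i\<in>B. v l i * v m i)"
      unfolding sum_distrib_left by (simp add: mult_ac)
    then show ?thesis using False by simp
  qed
  \<comment> \<open>Bessel's inequality for the orthonormal system \<open>v\<close> and the \<open>q\<close>-th unit vector\<close>
  have bessel: "(\<Sum>l\<in>L. (v l q)^2) \<le> 1" if q: "q \<in> B" for q
  proof -
    define e where "e i = (if i = q then 1 else 0 :: real)" for i
    have e: "(\<Sum>i\<in>B. e i * f i) = f q" for f :: "nat \<Rightarrow> real"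
      using q fin by (simp add: e_def if_distrib[of "\<lambda>x. x * _"] sum.delta cong: if_cong)
    define p where "p i = (\<Sum>l\<in>L. v l q * v l i)" for i
    have pp: "(\<Sum>i\<in>B. p i * p i) = (\<Sum>l\<in>L. (v l q)^2)"
    proof -
      have "(\<Sum>i\<in>B. p i * p i) = (\<Sum>i\<in>B. \<Sum>l\<in>L. \<Sum>m\<in>L. v l q * v m q * (v l i * v m i))"
        unfolding p_def sum_product by (simp add: mult_ac)
      also have "\<dots> = (\<Sum>l\<in>L. \<Sum>m\<in>L. v l q * v m q * (\<Sum>i\<in>B. v l i * v m i))"
        unfolding sum_distrib_left
        by (subst sum.swap, intro sum.cong refl, subst sum.swap, rule refl)
      also have "\<dots> = (\<Sum>l\<in>L. (v l q)^2)"
        using L(1) by (intro sum.cong refl)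
          (simp add: orth power2_eq_square if_distrib[of "\<lambda>x. _ * x"] sum.delta cong: if_cong)
      finally show ?thesis .
    qed
    have "0 \<le> (\<Sum>i\<in>B. (e i - p i)^2)" by (intro sum_nonneg) auto
    also have "\<dots> = (\<Sum>i\<in>B. e i * e i) - 2 * (\<Sum>i\<in>B. e i * p i) + (\<Sum>i\<in>B. p i * p i)"
      by (simp add: power2_eq_square algebra_simps sum.distrib sum_subtractf sum_distrib_left)
    also have "\<dots> = 1 - (\<Sum>l\<in>L. (v l q)^2)"
      unfolding pp e by (simp add: e_def p_def power2_eq_square)
    finally show ?thesis by simp
  qed
  have "real (card L) = (\<Sum>l\<in>L. \<Sum>q\<in>B. (v l q)^2)" using nrm by simp
  also have "\<dots> = (\<Sum>q\<in>B. \<Sum>l\<in>L. (v l q)^2)" by (rule sum.swap)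
  also have "\<dots> \<le> (\<Sum>q\<in>B. 1)" by (intro sum_mono bessel)
  finally show ?thesis by simp
qed

lemma finite_eigenvalues_on:
  assumes "finite B" "\<forall>i\<in>B. \<forall>j\<in>B. A i j = A j i"
  shows "finite (eigenvalues_on A B)"
proof (rule ccontr)
  assume "infinite (eigenvalues_on A B)"
  then obtain L where "finite L" "card L = Suc (card B)" "L \<subseteq> eigenvalues_on A B"
    using infinite_arbitrarily_large by blast
  then show False using card_eigenvalues_le[OF assms, of L] by simp
qed

text \<open>Read the eigenvector equation at a coordinate of maximal modulus: the row sum there is
  at most \<open>card B\<close> times that modulus.\<close>

lemma eigenvalue_le_card:
  assumes fin: "finite B" and bnd: "\<And>i j. i \<in> B \<Longrightarrow> j \<in> B \<Longrightarrow> \<bar>A i j\<bar> \<le> 1"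
    and l: "l \<in> eigenvalues_on A B"
  shows "l \<le> real (card B)"
proof -
  obtain v where v: "\<exists>q\<in>B. v q \<noteq> 0" "\<forall>q\<in>B. (\<Sum>q'\<in>B. A q q' * v q') = l * v q"
    using l unfolding eigenvalues_on_def by blast
  define M where "M = Max ((\<lambda>q. \<bar>v q\<bar>) ` B)"
  have "M \<in> (\<lambda>q. \<bar>v q\<bar>) ` B" unfolding M_def using fin v(1) by (intro Max_in) auto
  then obtain q where q: "q \<in> B" "M = \<bar>v q\<bar>" by auto
  have le: "\<bar>v r\<bar> \<le> M" if "r \<in> B" for r
    unfolding M_def using fin that by simp
  have "M > 0" using v(1) le by (metis abs_le_zero_iff not_less order_trans)
  have "\<bar>l\<bar> * M = \<bar>\<Sum>q'\<in>B. A q q' * v q'\<bar>" using v(2) q by (simp add: abs_mult)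
  also have "\<dots> \<le> (\<Sum>q'\<in>B. \<bar>A q q' * v q'\<bar>)" by (rule sum_abs)
  also have "\<dots> \<le> (\<Sum>q'\<in>B. 1 * M)"
    unfolding abs_mult using bnd le q \<open>M > 0\<close> by (intro sum_mono mult_mono) auto
  finally have "\<bar>l\<bar> * M \<le> real (card B) * M" by simp
  then show ?thesis using \<open>M > 0\<close> by simp
qed

lemma quad_form_le_largest_eig:
  assumes "finite B" "B \<noteq> {}" "\<forall>i\<in>B. \<forall>j\<in>B. A i j = A j i"
  shows "quad_form A B x \<le> largest_eig A B * (\<Sum>i\<in>B. (x i)^2)"
proof -
  obtain l where l: "l \<in> eigenvalues_on A B" "\<And>x. quad_form A B x \<le> l * (\<Sum>i\<in>B. (x i)^2)"
    using rayleigh_eigenvalue[OF assms] by blast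
  have "l \<le> largest_eig A B"
    unfolding largest_eig_def eigenvalues_on_def[symmetric]
    using finite_eigenvalues_on[OF assms(1,3)] l(1) by (rule Max_ge)
  then have "l * (\<Sum>i\<in>B. (x i)^2) \<le> largest_eig A B * (\<Sum>i\<in>B. (x i)^2)"
    by (intro mult_right_mono sum_nonneg) auto
  then show ?thesis using l(2)[of x] by linarith
qed

lemma largest_eig_le_card:
  assumes "finite B" "B \<noteq> {}" "\<forall>i\<in>B. \<forall>j\<in>B. A i j = A j i"
    and "\<And>i j. i \<in> B \<Longrightarrow> j \<in> B \<Longrightarrow> \<bar>A i j\<bar> \<le> 1"
  shows "largest_eig A B \<le> real (card B)"
proof -
  obtain l where "l \<in> eigenvalues_on A B"
    using rayleigh_eigenvalue[OF assms(1-3)] by blast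
  then have "largest_eig A B \<in> eigenvalues_on A B"
    unfolding largest_eig_def eigenvalues_on_def[symmetric]
    using finite_eigenvalues_on[OF assms(1,3)] by (intro Max_in) auto
  then show ?thesis by (rule eigenvalue_le_card[OF assms(1), rotated]) (rule assms(4))
qed

subsection \<open>Uniform random permutations\<close>

lemma finite_perms [simp]: "finite (perms N)"
  unfolding perms_def by (rule finite_permutations) simp

lemma card_perms: "card (perms N) = fact N"
  unfolding perms_def by (rule card_permutations) simp_all

lemma transpose_in_perms: "a < N \<Longrightarrow> b < N \<Longrightarrow> Transposition.transpose a b \<in> perms N"
  unfolding perms_def by (simp add: permutes_swap_id)

lemma sum_perms_reindex: "\<sigma> \<in> perms N \<Longrightarrow> (\<Sum>q<N. g (\<sigma> q)) = (\<Sum>i<N. g i)"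
  unfolding perms_def using sum.permute[of \<sigma> "{..<N}" g] by (simp add: o_def)

lemma Eperm_cong: "(\<And>\<sigma>. \<sigma> \<in> perms N \<Longrightarrow> f \<sigma> = g \<sigma>) \<Longrightarrow> Eperm N f = Eperm N g"
  unfolding Eperm_def by (simp cong: sum.cong)

lemma Eperm_add: "Eperm N (\<lambda>\<sigma>. f \<sigma> + g \<sigma>) = Eperm N f + Eperm N g"
  unfolding Eperm_def by (simp add: sum.distrib add_divide_distrib)

lemma Eperm_diff: "Eperm N (\<lambda>\<sigma>. f \<sigma> - g \<sigma>) = Eperm N f - Eperm N g"
  unfolding Eperm_def by (simp add: sum_subtractf diff_divide_distrib)

lemma Eperm_cmult: "Eperm N (\<lambda>\<sigma>. c * f \<sigma>) = c * Eperm N f"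
  unfolding Eperm_def by (simp add: sum_distrib_left)

lemma Eperm_cdiv: "Eperm N (\<lambda>\<sigma>. f \<sigma> / c) = Eperm N f / c"
  using Eperm_cmult[of N "1 / c" f] by simp

lemma Eperm_const: "Eperm N (\<lambda>\<sigma>. c) = c"
  unfolding Eperm_def by (simp add: card_perms)

lemma Eperm_sum: "Eperm N (\<lambda>\<sigma>. \<Sum>i\<in>I. f i \<sigma>) = (\<Sum>i\<in>I. Eperm N (f i))"
  unfolding Eperm_def by (subst sum.swap) (simp add: sum_divide_distrib)

lemma Eperm_mono:
  "(\<And>\<sigma>. \<sigma> \<in> perms N \<Longrightarrow> f \<sigma> \<le> g \<sigma>) \<Longrightarrow> Eperm N f \<le> Eperm N g"
  unfolding Eperm_def by (intro divide_right_mono sum_mono) auto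

text \<open>Exchangeability of the positions; the moment computations and the orthogonality argument
  for the Efron-Stein bound rest on it.\<close>

lemma Eperm_comp_right:
  assumes "\<rho> \<in> perms N"
  shows "Eperm N (\<lambda>\<sigma>. f (\<sigma> \<circ> \<rho>)) = Eperm N f"
  using sum_permutations_compose_right[of \<rho> "{..<N}" f] assms
  unfolding Eperm_def perms_def by simp

lemma mean_squared_le:
  fixes f :: "'a \<Rightarrow> real"
  assumes "finite I" "I \<noteq> {}"
  shows "((\<Sum>i\<in>I. f i) / real (card I))^2 \<le> (\<Sum>i\<in>I. (f i)^2) / real (card I)"
proof -
  have "card I > 0" using assms by (simp add: card_gt_0_iff)
  then show ?thesis
    using sum_squared_le_sum_of_squares[of f I]
    by (simp add: power_divide divide_simps power2_eq_square)
qed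

lemma Eperm_squared_le: "(Eperm N f)^2 \<le> Eperm N (\<lambda>\<sigma>. (f \<sigma>)^2)"
  using mean_squared_le[of "perms N" f] card_perms[of N]
  unfolding Eperm_def by (metis card.empty fact_nonzero finite_perms of_nat_fact)

lemma Pperm_markov:
  assumes nn: "\<And>\<sigma>. \<sigma> \<in> perms N \<Longrightarrow> 0 \<le> X \<sigma>" and E: "Eperm N X \<le> C * a"
    and a: "0 \<le> a" and C: "0 < C" and M: "0 < M"
  shows "Pperm N (\<lambda>\<sigma>. \<bar>X \<sigma>\<bar> > M * a) \<le> C / M"
proof -
  let ?A = "{\<sigma> \<in> perms N. \<bar>X \<sigma>\<bar> > M * a}"
  have P: "Pperm N (\<lambda>\<sigma>. \<bar>X \<sigma>\<bar> > M * a) = Eperm N (\<lambda>\<sigma>. if \<bar>X \<sigma>\<bar> > M * a then 1 else 0)"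
    unfolding Pperm_def Eperm_def by (simp add: sum.If_cases Int_def)
  show ?thesis
  proof (cases "a = 0")
    \<comment> \<open>The threshold \<open>M * a\<close> is 0 here and cannot be divided by. The
      mean is at most 0, so the nonnegative \<open>X\<close> vanishes on every permutation and the
      event is empty.\<close>
    case True
    have "(\<Sum>\<sigma>\<in>perms N. X \<sigma>) \<le> 0"
      using E True unfolding Eperm_def by (simp add: pos_divide_le_eq)
    then have "(\<Sum>\<sigma>\<in>perms N. X \<sigma>) = 0" using sum_nonneg[of "perms N" X] nn by force
    then have "\<forall>\<sigma>\<in>perms N. X \<sigma> = 0" using nn by (subst (asm) sum_nonneg_eq_0_iff) auto
    then have "?A = {}" using True by auto
    then show ?thesis unfolding Pperm_def \<open>?A = {}\<close> using C M by simp
  next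
    case False
    then have a': "a > 0" using a by simp
    have "Eperm N (\<lambda>\<sigma>. if \<bar>X \<sigma>\<bar> > M * a then 1 else 0) \<le> Eperm N (\<lambda>\<sigma>. X \<sigma> / (M * a))"
      using nn a' M by (intro Eperm_mono) (auto simp: divide_simps)
    also have "\<dots> = Eperm N X / (M * a)" by (rule Eperm_cdiv)
    also have "\<dots> \<le> C * a / (M * a)" using E a' M by (intro divide_right_mono) auto
    also have "\<dots> = C / M" using a' by simp
    finally show ?thesis unfolding P .
  qed
qed

lemma bigOP_of_mean_bound:
  assumes "\<forall>\<^sub>F N in sequentially. 0 \<le> a N \<and> Eperm N (X N) \<le> C * a N"
    and nn: "\<And>N \<sigma>. 0 \<le> X N \<sigma>" and C: "0 < C"
  shows "bigOP X a"
  unfolding bigOP_def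
proof (intro allI impI)
  fix \<epsilon> :: real assume \<epsilon>: "\<epsilon> > 0"
  obtain N0 where N0: "\<And>N. N \<ge> N0 \<Longrightarrow> 0 \<le> a N \<and> Eperm N (X N) \<le> C * a N"
    using assms(1) unfolding eventually_sequentially by blast
  \<comment> \<open>At \<open>M = C / \<epsilon>\<close> Markov's bound \<open>C / M\<close> equals
    \<open>\<epsilon>\<close>.\<close>
  have "Pperm N (\<lambda>\<sigma>. \<bar>X N \<sigma>\<bar> > C / \<epsilon> * a N) \<le> \<epsilon>" if "N \<ge> N0" for N
    using Pperm_markov[of N "X N" C "a N" "C / \<epsilon>"] N0[OF that] nn C \<epsilon> by simp
  then show "\<exists>M>0. \<exists>N0. \<forall>N\<ge>N0. Pperm N (\<lambda>\<sigma>. \<bar>X N \<sigma>\<bar> > M * a N) \<le> \<epsilon>"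
    using C \<epsilon> by (intro exI[of _ "C / \<epsilon>"]) auto
qed

section \<open>An Efron-Stein inequality for permutations\<close>

text \<open>For a permutation \<open>\<sigma>\<close> and \<open>S \<subseteq> {..<N}\<close> this
  is the conditional expectation of \<open>f\<close> given the units at positions outside
  \<open>S\<close>: composing on the right with \<open>\<rho>\<close> reshuffles only the units held
  by positions in \<open>S\<close>.\<close>

definition perm_avg :: "nat set \<Rightarrow> ((nat \<Rightarrow> nat) \<Rightarrow> real) \<Rightarrow> (nat \<Rightarrow> nat) \<Rightarrow> real" where
  "perm_avg S f \<sigma> = (\<Sum>\<rho> | \<rho> permutes S. f (\<sigma> \<circ> \<rho>)) / fact (card S)"

text \<open>Every permutation of \<open>insert a S\<close> is uniquely a permutation of
  \<open>S\<close> followed by a transposition of \<open>a\<close> with some \<open>b\<close>, which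
  splits the larger average into smaller ones.\<close>

lemma perm_avg_insert:
  assumes "finite S" "a \<notin> S"
  shows "perm_avg (insert a S) f \<sigma> =
    (\<Sum>b\<in>insert a S. perm_avg S f (\<sigma> \<circ> Transposition.transpose a b)) / real (card (insert a S))"
proof -
  have "perm_avg (insert a S) f \<sigma> =
      (\<Sum>b\<in>insert a S. \<Sum>\<rho> | \<rho> permutes S. f (\<sigma> \<circ> (Transposition.transpose a b \<circ> \<rho>))) / fact (card (insert a S))"
    unfolding perm_avg_def by (subst sum_over_permutations_insert[OF assms]) simp
  also have "\<dots> = (\<Sum>b\<in>insert a S. perm_avg S f (\<sigma> \<circ> Transposition.transpose a b)) / real (card (insert a S))"
    unfolding perm_avg_def using assms by (simp add: o_assoc sum_divide_distrib[symmetric])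
  finally show ?thesis .
qed

lemma perm_avg_comp:
  assumes "\<tau> permutes S"
  shows "perm_avg S f (\<sigma> \<circ> \<tau>) = perm_avg S f \<sigma>"
  using setum_permutations_compose_left[OF assms, of "\<lambda>\<rho>. f (\<sigma> \<circ> \<rho>)"]
  unfolding perm_avg_def by (simp add: o_assoc)

lemma perm_avg_full:
  assumes "\<sigma> \<in> perms N"
  shows "perm_avg {..<N} f \<sigma> = Eperm N f"
  using setum_permutations_compose_left[of \<sigma> "{..<N}" f] assms
  unfolding perm_avg_def Eperm_def perms_def by simp

lemma perm_avg_empty: "perm_avg {} f \<sigma> = f \<sigma>"
  by (simp add: perm_avg_def permutes_empty)

text \<open>Conjugation applies the inverse of \<open>\<rho>\<close> to both points of the
  transposition, and \<open>a\<close>, lying outside \<open>S\<close>, is fixed by it.\<close>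

lemma comp_transpose_conj:
  assumes "\<rho> permutes S" "a \<notin> S"
  shows "Transposition.transpose a b \<circ> \<rho> = \<rho> \<circ> Transposition.transpose a (inv \<rho> b)"
proof
  fix x
  have bij: "bij \<rho>" using assms(1) by (rule permutes_bij)
  have "\<rho> a = a" using assms permutes_not_in by metis
  moreover have "\<rho> (inv \<rho> b) = b" by (rule permutes_inverses(1)[OF assms(1)])
  moreover have "\<rho> x = \<rho> y \<longleftrightarrow> x = y" for y using bij by (simp add: bij_def inj_eq)
  ultimately show "(Transposition.transpose a b \<circ> \<rho>) x = (\<rho> \<circ> Transposition.transpose a (inv \<rho> b)) x"
    by (simp add: Transposition.transpose_def) metis
qed

text \<open>Conjugating by \<open>\<rho>\<close> moves the transposition to the inside of the average, so that averaging
  does not increase the mean square increments along transpositions.\<close>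

lemma perm_avg_increment_le:
  assumes S: "S \<subseteq> {..<N}" and a: "a < N" "a \<notin> S" and b: "b \<in> insert a S"
    and V: "\<And>j. j < N \<Longrightarrow> Eperm N (\<lambda>\<sigma>. (f (\<sigma> \<circ> Transposition.transpose a j) - f \<sigma>)^2) \<le> V"
  shows "Eperm N (\<lambda>\<sigma>. (perm_avg S f (\<sigma> \<circ> Transposition.transpose a b) - perm_avg S f \<sigma>)^2) \<le> V"
proof -
  have fin: "finite S" using S finite_subset by blast
  let ?G = "{\<rho>. \<rho> permutes S}"
  have G: "finite ?G" "?G \<noteq> {}" "card ?G = fact (card S)"
    using fin permutes_id[of S] by (auto simp: finite_permutations card_permutations simp del: permutes_id)
  define d where "d \<rho> \<sigma> = f (\<sigma> \<circ> Transposition.transpose a (inv \<rho> b)) - f \<sigma>" for \<rho> \<sigma>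
  have eq: "perm_avg S f (\<sigma> \<circ> Transposition.transpose a b) - perm_avg S f \<sigma> = (\<Sum>\<rho>\<in>?G. d \<rho> (\<sigma> \<circ> \<rho>)) / real (card ?G)" for \<sigma>
  proof -
    have "(\<Sum>\<rho>\<in>?G. f (\<sigma> \<circ> Transposition.transpose a b \<circ> \<rho>)) = (\<Sum>\<rho>\<in>?G. f (\<sigma> \<circ> \<rho> \<circ> Transposition.transpose a (inv \<rho> b)))"
      by (intro sum.cong refl) (simp add: comp_transpose_conj[OF _ a(2)] flip: o_assoc)
    then show ?thesis
      unfolding perm_avg_def d_def G(3) by (simp add: sum_subtractf diff_divide_distrib)
  qed
  have "Eperm N (\<lambda>\<sigma>. (perm_avg S f (\<sigma> \<circ> Transposition.transpose a b) - perm_avg S f \<sigma>)^2)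
      \<le> Eperm N (\<lambda>\<sigma>. (\<Sum>\<rho>\<in>?G. (d \<rho> (\<sigma> \<circ> \<rho>))^2) / real (card ?G))"
    unfolding eq by (intro Eperm_mono mean_squared_le G)
  also have "\<dots> = (\<Sum>\<rho>\<in>?G. Eperm N (\<lambda>\<sigma>. (d \<rho> (\<sigma> \<circ> \<rho>))^2)) / real (card ?G)"
    unfolding Eperm_cdiv Eperm_sum ..
  also have "\<dots> \<le> (\<Sum>\<rho>\<in>?G. V) / real (card ?G)"
  proof (intro divide_right_mono sum_mono)
    fix \<rho> assume "\<rho> \<in> ?G"
    then have \<rho>: "\<rho> permutes S" by simp
    have "\<rho> \<in> perms N" unfolding perms_def using permutes_subset[OF \<rho> S] by simp
    then have "Eperm N (\<lambda>\<sigma>. (d \<rho> (\<sigma> \<circ> \<rho>))^2) = Eperm N (\<lambda>\<sigma>. (d \<rho> \<sigma>)^2)"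
      by (rule Eperm_comp_right)
    also have "\<dots> \<le> V"
    proof -
      have "inv \<rho> b \<in> insert a S"
        using permutes_subset[OF permutes_inv[OF \<rho>] subset_insertI] b permutes_in_image by metis
      then have "inv \<rho> b < N" using S a by auto
      then show ?thesis unfolding d_def by (rule V)
    qed
    finally show "Eperm N (\<lambda>\<sigma>. (d \<rho> (\<sigma> \<circ> \<rho>))^2) \<le> V" .
  qed simp
  also have "\<dots> = V" using G by simp
  finally show ?thesis .
qed

text \<open>Enlarging \<open>S\<close> by one position is an orthogonal projection, so the loss of
  second moment is the mean square of \<open>h - g\<close>. Jensen's inequality over
  \<open>b\<close> and the increment bound keep it below \<open>V\<close>, and the losses add up
  over \<open>card S\<close> steps.\<close>

lemma perm_avg_second_moment_drop:
  assumes S: "S \<subseteq> {..<N}"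
    and V: "\<And>k j. k < N \<Longrightarrow> j < N \<Longrightarrow> Eperm N (\<lambda>\<sigma>. (f (\<sigma> \<circ> Transposition.transpose k j) - f \<sigma>)^2) \<le> V"
  shows "Eperm N (\<lambda>\<sigma>. (f \<sigma>)^2) - Eperm N (\<lambda>\<sigma>. (perm_avg S f \<sigma>)^2) \<le> real (card S) * V"
proof -
  have "finite S" using S finite_subset by blast
  then show ?thesis using S
  proof (induction S)
    case empty
    then show ?case by (simp add: perm_avg_empty)
  next
    case (insert a S)
    have a: "a < N" and SN: "S \<subseteq> {..<N}" using insert by auto
    define T where "T = insert a S"
    define g where "g = perm_avg S f"
    define h where "h = perm_avg T f"
    have T: "finite T" "T \<noteq> {}" "card T = Suc (card S)" "T \<subseteq> {..<N}"
      using insert by (auto simp: T_def)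
    have cT: "real (card T) > 0" using T by simp
    have h: "h \<sigma> = (\<Sum>b\<in>T. g (\<sigma> \<circ> Transposition.transpose a b)) / real (card T)" for \<sigma>
      unfolding h_def g_def T_def using insert by (intro perm_avg_insert) auto
    have tr: "Transposition.transpose a b \<in> perms N" if "b \<in> T" for b
      using that T(4) a by (intro transpose_in_perms) auto
    \<comment> \<open>Both \<open>h\<close> and the uniform law are invariant under the
      transposition, so \<open>g\<close> may be replaced by its transposed version. Averaging over
      \<open>b\<close> then turns \<open>g\<close> into \<open>h\<close>.\<close>
    have "Eperm N (\<lambda>\<sigma>. g \<sigma> * h \<sigma>) = Eperm N (\<lambda>\<sigma>. g (\<sigma> \<circ> Transposition.transpose a b) * h \<sigma>)" if "b \<in> T" for b
    proof -
      have hh: "h (\<sigma> \<circ> Transposition.transpose a b) = h \<sigma>" for \<sigma>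
        unfolding h_def using that
        by (intro perm_avg_comp permutes_swap_id) (auto simp: T_def)
      show ?thesis
        using Eperm_comp_right[OF tr[OF that], of "\<lambda>\<sigma>. g \<sigma> * h \<sigma>"] by (simp add: hh)
    qed
    then have "(\<Sum>b\<in>T. Eperm N (\<lambda>\<sigma>. g \<sigma> * h \<sigma>)) = (\<Sum>b\<in>T. Eperm N (\<lambda>\<sigma>. g (\<sigma> \<circ> Transposition.transpose a b) * h \<sigma>))"
      by (intro sum.cong refl)
    also have "\<dots> = Eperm N (\<lambda>\<sigma>. (\<Sum>b\<in>T. g (\<sigma> \<circ> Transposition.transpose a b)) * h \<sigma>)"
      unfolding Eperm_sum[symmetric] sum_distrib_right ..
    also have "\<dots> = Eperm N (\<lambda>\<sigma>. real (card T) * (h \<sigma>)^2)"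
      using cT by (simp add: h power2_eq_square)
    finally have gh: "Eperm N (\<lambda>\<sigma>. g \<sigma> * h \<sigma>) = Eperm N (\<lambda>\<sigma>. (h \<sigma>)^2)"
      using cT by (simp add: Eperm_cmult)
    have "Eperm N (\<lambda>\<sigma>. (h \<sigma> - g \<sigma>)^2) = Eperm N (\<lambda>\<sigma>. (h \<sigma>)^2 - 2 * (g \<sigma> * h \<sigma>) + (g \<sigma>)^2)"
      by (intro Eperm_cong) (simp add: power2_eq_square algebra_simps)
    also have "\<dots> = Eperm N (\<lambda>\<sigma>. (g \<sigma>)^2) - Eperm N (\<lambda>\<sigma>. (h \<sigma>)^2)"
      by (simp add: Eperm_add Eperm_diff Eperm_cmult gh)
    finally have pyth: "Eperm N (\<lambda>\<sigma>. (g \<sigma>)^2) - Eperm N (\<lambda>\<sigma>. (h \<sigma>)^2) = Eperm N (\<lambda>\<sigma>. (h \<sigma> - g \<sigma>)^2)"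
      by simp
    have "h \<sigma> - g \<sigma> = (\<Sum>b\<in>T. g (\<sigma> \<circ> Transposition.transpose a b) - g \<sigma>) / real (card T)" for \<sigma>
      unfolding h using cT by (simp add: sum_subtractf diff_divide_distrib)
    then have "Eperm N (\<lambda>\<sigma>. (h \<sigma> - g \<sigma>)^2)
        \<le> Eperm N (\<lambda>\<sigma>. (\<Sum>b\<in>T. (g (\<sigma> \<circ> Transposition.transpose a b) - g \<sigma>)^2) / real (card T))"
      by (simp only:) (intro Eperm_mono mean_squared_le T)
    also have "\<dots> = (\<Sum>b\<in>T. Eperm N (\<lambda>\<sigma>. (g (\<sigma> \<circ> Transposition.transpose a b) - g \<sigma>)^2)) / real (card T)"
      unfolding Eperm_cdiv Eperm_sum ..
    also have "\<dots> \<le> (\<Sum>b\<in>T. V) / real (card T)"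
      unfolding g_def T_def using insert SN a V
      by (intro divide_right_mono sum_mono perm_avg_increment_le) auto
    also have "\<dots> = V" using cT by simp
    finally have "Eperm N (\<lambda>\<sigma>. (g \<sigma>)^2) - Eperm N (\<lambda>\<sigma>. (h \<sigma>)^2) \<le> V" unfolding pyth .
    then show ?case
      using insert.IH[OF SN] T(3) unfolding g_def h_def T_def by (simp add: algebra_simps)
  qed
qed

text \<open>Averaging over all positions leaves the constant \<open>Eperm N f\<close>, so the total
  drop of the second moment is the variance, reached in \<open>N\<close> steps.\<close>

lemma Eperm_variance_le:
  assumes "\<And>k j. k < N \<Longrightarrow> j < N \<Longrightarrow> Eperm N (\<lambda>\<sigma>. (f (\<sigma> \<circ> Transposition.transpose k j) - f \<sigma>)^2) \<le> V"
  shows "Eperm N (\<lambda>\<sigma>. (f \<sigma> - Eperm N f)^2) \<le> real N * V"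
proof -
  define m where "m = Eperm N f"
  have "Eperm N (\<lambda>\<sigma>. (f \<sigma> - m)^2) = Eperm N (\<lambda>\<sigma>. (f \<sigma>)^2 - 2 * m * f \<sigma> + m^2)"
    by (intro Eperm_cong) (simp add: power2_eq_square algebra_simps)
  also have "\<dots> = Eperm N (\<lambda>\<sigma>. (f \<sigma>)^2) - m^2"
    by (simp add: Eperm_add Eperm_diff Eperm_cmult Eperm_const m_def[symmetric] power2_eq_square)
  also have "m^2 = Eperm N (\<lambda>\<sigma>. (perm_avg {..<N} f \<sigma>)^2)"
    using Eperm_const[of N "m^2"]
    by (simp add: m_def perm_avg_full cong: Eperm_cong)
  also have "Eperm N (\<lambda>\<sigma>. (f \<sigma>)^2) - \<dots> \<le> real (card {..<N}) * V"
    using assms by (intro perm_avg_second_moment_drop) auto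
  finally show ?thesis by (simp add: m_def)
qed

subsection \<open>Mean of the variance estimator\<close>

text \<open>By exchangeability the mean is the same at every position, and the sum over all
  positions is deterministic; no permutations need to be counted.\<close>

lemma Eperm_marginal:
  assumes q: "q < N"
  shows "Eperm N (\<lambda>\<sigma>. g (\<sigma> q)) = (\<Sum>i<N. g i) / real N"
proof -
  have "Eperm N (\<lambda>\<sigma>. g (\<sigma> r)) = Eperm N (\<lambda>\<sigma>. g (\<sigma> q))" if "r < N" for r
    using Eperm_comp_right[OF transpose_in_perms[OF q that], of "\<lambda>\<sigma>. g (\<sigma> q)"] by simp
  then have "(\<Sum>r<N. Eperm N (\<lambda>\<sigma>. g (\<sigma> r))) = (\<Sum>r<N. Eperm N (\<lambda>\<sigma>. g (\<sigma> q)))"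
    by (intro sum.cong) auto
  moreover have "(\<Sum>r<N. Eperm N (\<lambda>\<sigma>. g (\<sigma> r))) = (\<Sum>i<N. g i)"
    unfolding Eperm_sum[symmetric] using Eperm_const[of N "\<Sum>i<N. g i"]
    by (simp add: sum_perms_reindex cong: Eperm_cong)
  ultimately show ?thesis using q by simp
qed

text \<open>By exchangeability \<open>r\<close> may be replaced by any position other than
  \<open>q\<close>. Since \<open>h\<close> is centred, its values over these positions sum to
  \<open>- h (\<sigma> q)\<close>, which leaves a one-position mean.\<close>

lemma Eperm_pair_centered:
  assumes q: "q < N" "r < N" "q \<noteq> r" and h: "(\<Sum>i<N. h i) = 0"
  shows "Eperm N (\<lambda>\<sigma>. g (\<sigma> q) * h (\<sigma> r)) = - (\<Sum>i<N. g i * h i) / (real N * (real N - 1))"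
proof -
  have "Eperm N (\<lambda>\<sigma>. g (\<sigma> q) * h (\<sigma> s)) = Eperm N (\<lambda>\<sigma>. g (\<sigma> q) * h (\<sigma> r))"
    if "s \<in> {..<N} - {q}" for s
  proof -
    have "Transposition.transpose r s q = q" using that q by (simp add: Transposition.transpose_def)
    then show ?thesis
      using Eperm_comp_right[of "Transposition.transpose r s" N "\<lambda>\<sigma>. g (\<sigma> q) * h (\<sigma> r)"] that q
      by (simp add: transpose_in_perms)
  qed
  then have "(\<Sum>s\<in>{..<N} - {q}. Eperm N (\<lambda>\<sigma>. g (\<sigma> q) * h (\<sigma> s)))
      = (\<Sum>s\<in>{..<N} - {q}. Eperm N (\<lambda>\<sigma>. g (\<sigma> q) * h (\<sigma> r)))"
    by (intro sum.cong refl)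
  also have "\<dots> = (real N - 1) * Eperm N (\<lambda>\<sigma>. g (\<sigma> q) * h (\<sigma> r))"
    using q by (simp add: of_nat_diff)
  finally have A: "(\<Sum>s\<in>{..<N} - {q}. Eperm N (\<lambda>\<sigma>. g (\<sigma> q) * h (\<sigma> s)))
      = (real N - 1) * Eperm N (\<lambda>\<sigma>. g (\<sigma> q) * h (\<sigma> r))" .
  have "(\<Sum>s\<in>{..<N} - {q}. Eperm N (\<lambda>\<sigma>. g (\<sigma> q) * h (\<sigma> s)))
      = Eperm N (\<lambda>\<sigma>. g (\<sigma> q) * (\<Sum>s\<in>{..<N} - {q}. h (\<sigma> s)))"
    unfolding Eperm_sum[symmetric] sum_distrib_left ..
  also have "\<dots> = Eperm N (\<lambda>\<sigma>. - (g (\<sigma> q) * h (\<sigma> q)))"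
  proof (rule Eperm_cong)
    fix \<sigma> assume "\<sigma> \<in> perms N"
    then have "(\<Sum>s<N. h (\<sigma> s)) = 0" using h by (simp add: sum_perms_reindex)
    then have "(\<Sum>s\<in>{..<N} - {q}. h (\<sigma> s)) = - h (\<sigma> q)"
      using q by (simp add: sum_diff1)
    then show "g (\<sigma> q) * (\<Sum>s\<in>{..<N} - {q}. h (\<sigma> s)) = - (g (\<sigma> q) * h (\<sigma> q))" by simp
  qed
  also have "\<dots> = - (\<Sum>i<N. g i * h i) / real N"
    using Eperm_marginal[OF q(1), of "\<lambda>i. - (g i * h i)"] by (simp add: sum_negf)
  finally have "(real N - 1) * Eperm N (\<lambda>\<sigma>. g (\<sigma> q) * h (\<sigma> r)) = - (\<Sum>i<N. g i * h i) / real N"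
    using A by simp
  moreover have "real N - 1 \<noteq> 0" "real N \<noteq> 0" using q by auto
  ultimately show ?thesis by (simp add: field_simps)
qed

section \<open>Covariances of the centred outcomes\<close>

definition dev :: "(nat \<Rightarrow> nat \<Rightarrow> real) \<Rightarrow> nat \<Rightarrow> nat \<Rightarrow> nat \<Rightarrow> real" where
  "dev Y N i q = Y i q - Ybar Y N q"

lemma sum_dev: "(\<Sum>i<N. dev Y N i q) = 0"
  by (cases "N = 0") (simp_all add: dev_def Ybar_def sum_subtractf)

lemma Scov_dev: "Scov Y N q r = (\<Sum>i<N. dev Y N i q * dev Y N i r) / (real N - 1)"
  by (simp add: Scov_def dev_def)

lemma Scov_sym: "Scov Y N q r = Scov Y N r q"
  by (simp add: Scov_def mult.commute)

lemma Scor_sym: "Scor Y N q r = Scor Y N r q"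
  by (simp add: Scor_def Scov_sym[of Y N q r] mult.commute)

lemma quad_form_Scov:
  "(\<Sum>q\<in>B. \<Sum>r\<in>B. x q * Scov Y N q r * x r) = (\<Sum>i<N. (\<Sum>q\<in>B. x q * dev Y N i q)^2) / (real N - 1)"
proof -
  have "(\<Sum>i<N. (\<Sum>q\<in>B. x q * dev Y N i q)^2)
      = (\<Sum>i<N. \<Sum>q\<in>B. \<Sum>r\<in>B. x q * dev Y N i q * (x r * dev Y N i r))"
    by (simp add: power2_eq_square sum_product)
  also have "\<dots> = (\<Sum>q\<in>B. \<Sum>i<N. \<Sum>r\<in>B. x q * dev Y N i q * (x r * dev Y N i r))"
    by (rule sum.swap)
  also have "\<dots> = (\<Sum>q\<in>B. \<Sum>r\<in>B. \<Sum>i<N. x q * dev Y N i q * (x r * dev Y N i r))"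
    by (intro sum.cong refl sum.swap)
  also have "\<dots> / (real N - 1) = (\<Sum>q\<in>B. \<Sum>r\<in>B. x q * Scov Y N q r * x r)"
    unfolding sum_divide_distrib Scov_dev sum_distrib_left sum_distrib_right
    by (intro sum.cong refl) (simp add: mult_ac)
  finally show ?thesis by simp
qed

lemma quad_form_Scov_nonneg:
  "N \<ge> 1 \<Longrightarrow> 0 \<le> (\<Sum>q\<in>B. \<Sum>r\<in>B. x q * Scov Y N q r * x r)"
  unfolding quad_form_Scov by (intro divide_nonneg_nonneg sum_nonneg) auto

text \<open>Both inequalities say that the outcome of \<open>q\<close> plus \<open>c\<close> times
  the outcome of \<open>r\<close> has nonnegative variance, for \<open>c = 1\<close> and
  \<open>c = -1\<close>.\<close>

lemma Scov_pair_nonneg: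
  assumes "N \<ge> 1"
  shows "0 \<le> Scov Y N q q + 2 * Scov Y N q r + Scov Y N r r" (is ?plus)
    and "2 * Scov Y N q r \<le> Scov Y N q q + Scov Y N r r" (is ?minus)
proof -
  have *: "Scov Y N q q + 2 * c * Scov Y N q r + c^2 * Scov Y N r r
      = (\<Sum>i<N. (dev Y N i q + c * dev Y N i r)^2) / (real N - 1)" for c
    unfolding Scov_dev
    by (simp add: power2_eq_square algebra_simps sum.distrib sum_distrib_left
        add_divide_distrib[symmetric] del: add_divide_distrib)
  have "0 \<le> Scov Y N q q + 2 * c * Scov Y N q r + c^2 * Scov Y N r r" for c
    unfolding * using assms by (intro divide_nonneg_nonneg sum_nonneg) auto
  from this[of 1] this[of "-1"] show ?plus ?minus by simp_all
qed

lemma abs_Scor_le_1: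
  assumes "N \<ge> 1"
  shows "\<bar>Scor Y N q r\<bar> \<le> 1"
proof -
  have "(\<Sum>i<N. dev Y N i q * dev Y N i r)^2 \<le> (\<Sum>i<N. (dev Y N i q)^2) * (\<Sum>i<N. (dev Y N i r)^2)"
    by (rule Cauchy_Schwarz_ineq_sum)
  then have "(Scov Y N q r)^2 \<le> Scov Y N q q * Scov Y N r r"
    unfolding Scov_dev by (simp add: power_divide power2_eq_square[symmetric] divide_right_mono)
  then have "\<bar>Scov Y N q r\<bar> \<le> sqrt (Scov Y N q q * Scov Y N r r)"
    using real_le_rsqrt by fastforce
  \<comment> \<open>The case \<open>s = 0\<close>, a level with zero variance, is included because
    division by zero yields 0.\<close>
  moreover have "\<bar>a / s\<bar> \<le> 1" if "\<bar>a\<bar> \<le> s" for a s :: real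
    using that abs_ge_zero[of a] by (auto simp: divide_le_eq_1 simp del: abs_ge_zero)
  ultimately show ?thesis unfolding Scor_def by blast
qed

text \<open>Sampling without replacement: the diagonal loses the fraction \<open>1 / N\<close> by
  the change of divisor from \<open>N - 1\<close> to \<open>N\<close>, and off the diagonal centring
  gives the covariance \<open>- S / N\<close>.\<close>

lemma Eperm_dev_product:
  assumes "q < N" "r < N" "N \<ge> 2"
  shows "Eperm N (\<lambda>\<sigma>. dev Y N (\<sigma> q) q * dev Y N (\<sigma> r) r) = VY Y N q r"
proof (cases "q = r")
  case True
  have "Eperm N (\<lambda>\<sigma>. dev Y N (\<sigma> q) q * dev Y N (\<sigma> q) q) = (real N - 1) * Scov Y N q q / real N"
    using assms Eperm_marginal[of q N "\<lambda>i. dev Y N i q * dev Y N i q"] by (simp add: Scov_dev)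
  then show ?thesis using True assms by (simp add: VY_def field_simps)
next
  case False
  then show ?thesis
    using Eperm_pair_centered[OF assms(1,2) False sum_dev, of "\<lambda>i. dev Y N i q"]
    by (simp add: VY_def Scov_dev)
qed

lemma Eperm_affine_squared:
  assumes B: "finite B" "B \<subseteq> {..<N}" and N: "N \<ge> 2"
  shows "Eperm N (\<lambda>\<sigma>. (c + (\<Sum>r\<in>B. w r * dev Y N (\<sigma> r) r))^2)
    = c^2 + (\<Sum>r\<in>B. \<Sum>s\<in>B. w r * w s * VY Y N r s)"
proof -
  have "(c + (\<Sum>r\<in>B. w r * dev Y N (\<sigma> r) r))^2 = c^2 + (\<Sum>r\<in>B. 2 * c * w r * dev Y N (\<sigma> r) r)
      + (\<Sum>r\<in>B. \<Sum>s\<in>B. w r * w s * (dev Y N (\<sigma> r) r * dev Y N (\<sigma> s) s))" for \<sigma>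
    unfolding power2_sum
    by (simp add: power2_eq_square sum_product sum_distrib_left mult_ac)
  moreover have "Eperm N (\<lambda>\<sigma>. dev Y N (\<sigma> r) r) = 0" if "r \<in> B" for r
    using that B Eperm_marginal[of r N "\<lambda>i. dev Y N i r"] by (auto simp: sum_dev)
  moreover have "Eperm N (\<lambda>\<sigma>. dev Y N (\<sigma> r) r * dev Y N (\<sigma> s) s) = VY Y N r s"
    if "r \<in> B" "s \<in> B" for r s
    using that B N by (intro Eperm_dev_product) auto
  ultimately show ?thesis
    by (simp add: Eperm_add Eperm_const Eperm_sum Eperm_cmult)
qed

section \<open>Groups and residuals within a group\<close>

lemma grp_eqI:
  assumes "is_grouping N P" "B \<in> P" "q \<in> B"
  shows "grp P q = B"
  unfolding grp_def
proof (rule the_equality)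
  show "B \<in> P \<and> q \<in> B" using assms by simp
next
  fix A assume A: "A \<in> P \<and> q \<in> A"
  then have "A \<inter> B \<noteq> {}" using assms(3) by auto
  then show "A = B" using assms(1,2) A unfolding is_grouping_def by metis
qed

lemma grp_props:
  assumes "is_grouping N P" "q < N"
  shows "grp P q \<in> P" "q \<in> grp P q"
proof -
  have "q \<in> \<Union>P" using assms unfolding is_grouping_def by simp
  then obtain B where "B \<in> P" "q \<in> B" by blast
  then show "grp P q \<in> P" "q \<in> grp P q" using grp_eqI[OF assms(1)] by auto
qed

lemma group_props:
  assumes "is_grouping N P" "B \<in> P"
  shows "B \<subseteq> {..<N}" "finite B" "card B \<ge> 2"
proof -
  show "B \<subseteq> {..<N}" using assms unfolding is_grouping_def by blast
  then show "finite B" using finite_subset by blast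
  show "card B \<ge> 2" using assms unfolding is_grouping_def by blast
qed

lemma mu_nonneg: "N > 2 \<Longrightarrow> 0 \<le> mu N B"
  unfolding mu_def by (intro mult_nonneg_nonneg) auto

text \<open>Stated for an arbitrary map \<open>s\<close>, so that it also covers assignments using a
  unit twice in the fluctuation bounds.\<close>

lemma group_residual_dev:
  "Yobs Y s q - Yhat_grp Y s B = (Ybar Y N q - Ybar_grp Y N B)
    + dev Y N (s q) q - (\<Sum>r\<in>B. dev Y N (s r) r) / real (card B)"
  unfolding Yobs_def Yhat_grp_def Ybar_grp_def
  by (simp add: dev_def sum_subtractf diff_divide_distrib Yobs_def)

lemma group_residual_eq:
  assumes "finite B" "q \<in> B"
  shows "Yobs Y \<sigma> q - Yhat_grp Y \<sigma> B = (Ybar Y N q - Ybar_grp Y N B)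
    + (\<Sum>r\<in>B. ((if r = q then 1 else 0) - 1 / real (card B)) * dev Y N (\<sigma> r) r)"
proof -
  have "(\<Sum>r\<in>B. ((if r = q then 1 else 0) - 1 / real (card B)) * dev Y N (\<sigma> r) r)
      = (\<Sum>r\<in>B. if r = q then dev Y N (\<sigma> q) q else 0) - (\<Sum>r\<in>B. dev Y N (\<sigma> r) r / real (card B))"
    unfolding sum_subtractf[symmetric] by (intro sum.cong refl) (simp add: algebra_simps)
  also have "\<dots> = dev Y N (\<sigma> q) q - (\<Sum>r\<in>B. dev Y N (\<sigma> r) r) / real (card B)"
    using assms by (simp add: sum_divide_distrib)
  finally show ?thesis using group_residual_dev[of Y \<sigma> q B N] by simp
qed

text \<open>\<open>VY\<close> is a diagonal matrix minus \<open>S / N\<close>, and the variance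
  splits accordingly. Each piece is then separated into the weight \<open>1 - 1 / b\<close> at
  \<open>q\<close> and the weight \<open>- 1 / b\<close> on the rest of the group.\<close>

lemma centering_variance:
  assumes "finite B" "q \<in> B"
  defines "b \<equiv> real (card B)"
  shows "(\<Sum>r\<in>B. \<Sum>s\<in>B. ((if r = q then 1 else 0) - 1 / b) * ((if s = q then 1 else 0) - 1 / b) * VY Y N r s)
    = (1 - 1 / b)^2 * Scov Y N q q + (\<Sum>r\<in>B - {q}. Scov Y N r r) / b^2
      - ((1 - 1 / b)^2 * Scov Y N q q - 2 * (1 - 1 / b) / b * (\<Sum>r\<in>B - {q}. Scov Y N q r)
         + (\<Sum>r\<in>B - {q}. \<Sum>s\<in>B - {q}. Scov Y N r s) / b^2) / real N"
proof -
  define w where "w r = (if r = q then 1 else 0) - 1 / b" for r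
  have wq: "w q = 1 - 1 / b" and wC: "\<And>r. r \<in> B - {q} \<Longrightarrow> w r = - (1 / b)" by (auto simp: w_def)
  have "(\<Sum>r\<in>B. \<Sum>s\<in>B. w r * w s * VY Y N r s)
      = (\<Sum>r\<in>B. (\<Sum>s\<in>B. if r = s then w r * w r * Scov Y N r r else 0) - (\<Sum>s\<in>B. w r * w s * Scov Y N r s) / real N)"
    unfolding VY_def sum_divide_distrib sum_subtractf[symmetric]
    by (intro sum.cong refl) (auto simp: algebra_simps)
  also have "\<dots> = (\<Sum>r\<in>B. w r * w r * Scov Y N r r) - (\<Sum>r\<in>B. \<Sum>s\<in>B. w r * w s * Scov Y N r s) / real N"
    using assms(1) by (simp add: sum_subtractf sum_divide_distrib)
  also have "(\<Sum>r\<in>B. w r * w r * Scov Y N r r) = (1 - 1 / b)^2 * Scov Y N q q + (\<Sum>r\<in>B - {q}. Scov Y N r r) / b^2"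
    unfolding sum.remove[OF assms(1,2)] wq
    by (simp add: wC power2_eq_square sum_divide_distrib cong: sum.cong_simp)
  also have "(\<Sum>r\<in>B. \<Sum>s\<in>B. w r * w s * Scov Y N r s)
      = (1 - 1 / b)^2 * Scov Y N q q - 2 * (1 - 1 / b) / b * (\<Sum>r\<in>B - {q}. Scov Y N q r)
         + (\<Sum>r\<in>B - {q}. \<Sum>s\<in>B - {q}. Scov Y N r s) / b^2"
  proof -
    have row: "(\<Sum>s\<in>B. w s * Scov Y N r s) = (1 - 1 / b) * Scov Y N q r - (\<Sum>s\<in>B - {q}. Scov Y N r s) / b" for r
      unfolding sum.remove[OF assms(1,2)] wq Scov_sym[of Y N q r]
      by (simp add: wC sum_divide_distrib sum_negf cong: sum.cong_simp)
    have "(\<Sum>r\<in>B. \<Sum>s\<in>B. w r * w s * Scov Y N r s) = (\<Sum>r\<in>B. w r * (\<Sum>s\<in>B. w s * Scov Y N r s))"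
      by (simp add: sum_distrib_left mult.assoc)
    also have "\<dots> = (1 - 1 / b) * ((1 - 1 / b) * Scov Y N q q - (\<Sum>s\<in>B - {q}. Scov Y N q s) / b)
        + (\<Sum>r\<in>B - {q}. - (1 / b) * ((1 - 1 / b) * Scov Y N q r - (\<Sum>s\<in>B - {q}. Scov Y N r s) / b))"
      unfolding row unfolding sum.remove[OF assms(1,2)] wq
      by (simp add: wC cong: sum.cong_simp)
    also have "(\<Sum>r\<in>B - {q}. - (1 / b) * ((1 - 1 / b) * Scov Y N q r - (\<Sum>s\<in>B - {q}. Scov Y N r s) / b))
        = - (1 / b) * ((1 - 1 / b) * (\<Sum>r\<in>B - {q}. Scov Y N q r) - (\<Sum>r\<in>B - {q}. \<Sum>s\<in>B - {q}. Scov Y N r s) / b)"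
      unfolding sum_distrib_left[symmetric] sum_subtractf sum_divide_distrib[symmetric] ..
    finally show ?thesis
      by (simp add: power2_eq_square algebra_simps diff_divide_distrib add_divide_distrib)
  qed
  finally show ?thesis unfolding w_def .
qed

text \<open>The test vector with entries \<open>sqrt (Scov Y N r r)\<close> turns correlations into
  covariances; setting it to 0 at \<open>q\<close> removes \<open>q\<close> while keeping the
  eigenvalue of the whole group.\<close>

lemma rho_dominates_Scov:
  assumes B: "finite B" "q \<in> B" "card B \<ge> 2" and pos: "\<forall>r\<in>B. Scov Y N r r > 0"
  shows "(\<Sum>r\<in>B - {q}. \<Sum>s\<in>B - {q}. Scov Y N r s) \<le> rho Y N B * (\<Sum>r\<in>B - {q}. Scov Y N r r)"
proof -
  define x where "x r = (if r = q then 0 else sqrt (Scov Y N r r))" for r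
  have "quad_form (Scor Y N) B x = (\<Sum>r\<in>B - {q}. \<Sum>s\<in>B - {q}. x r * Scor Y N r s * x s)"
    unfolding quad_form_def sum.remove[OF B(1,2)] by (simp add: x_def)
  also have "\<dots> = (\<Sum>r\<in>B - {q}. \<Sum>s\<in>B - {q}. Scov Y N r s)"
  proof (intro sum.cong refl)
    fix r s assume "r \<in> B - {q}" "s \<in> B - {q}"
    then have "Scov Y N r r > 0" "Scov Y N s s > 0" "r \<noteq> q" "s \<noteq> q" using pos by auto
    then show "x r * Scor Y N r s * x s = Scov Y N r s"
      by (simp add: x_def Scor_def real_sqrt_mult)
  qed
  finally have *: "quad_form (Scor Y N) B x = (\<Sum>r\<in>B - {q}. \<Sum>s\<in>B - {q}. Scov Y N r s)" .
  have "(\<Sum>r\<in>B. (x r)^2) = (\<Sum>r\<in>B - {q}. Scov Y N r r)"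
    unfolding sum.remove[OF B(1,2)] using pos by (simp add: x_def less_imp_le cong: sum.cong_simp)
  then show ?thesis
    using quad_form_le_largest_eig[of B "Scor Y N" x] B Scor_sym[of Y N]
    unfolding rho_def * by auto
qed

lemma rho_le_card:
  assumes "finite B" "B \<noteq> {}" "N \<ge> 1"
  shows "rho Y N B \<le> real (card B)"
  unfolding rho_def using assms Scor_sym[of Y N] abs_Scor_le_1[of N Y]
  by (intro largest_eig_le_card) auto

section \<open>The exact mean and its remainder\<close>

definition Theta :: "nat set set \<Rightarrow> (nat \<Rightarrow> nat \<Rightarrow> real) \<Rightarrow> nat \<Rightarrow> nat \<Rightarrow> real" where
  "Theta P Y N q = (let B = grp P q; b = real (card B); C = B - {q} in
     mu N B / b^2 * ((b - 1) * (\<Sum>r\<in>C. Scov Y N q q + 2 * Scov Y N q r + Scov Y N r r)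
       + (rho Y N B * (\<Sum>r\<in>C. Scov Y N r r) - (\<Sum>r\<in>C. \<Sum>s\<in>C. Scov Y N r s))))"

text \<open>The constant is 5 = 4 + 1. Each pair sum in \<open>R\<close> is at most
  \<open>4 * M\<close>, and there are \<open>b - 1\<close> of them, so \<open>(b - 1) * R\<close> is
  below \<open>4 * M * b^2\<close>; \<open>rho\<close> at most \<open>b\<close> bounds
  \<open>rho * T\<close> by \<open>M * b^2\<close>; the nonnegative \<open>W\<close> is
  dropped.\<close>

lemma Theta_bounds:
  assumes N: "N > 2" and P: "is_grouping N P" and pos: "\<forall>q<N. Scov Y N q q > 0" and q: "q < N"
  shows "0 \<le> Theta P Y N q"
    and "Theta P Y N q \<le> 5 * mu N (grp P q) * Max ((\<lambda>q'. Scov Y N q' q') ` grp P q)"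
proof -
  define B where "B = grp P q"
  define b where "b = real (card B)"
  define C where "C = B - {q}"
  define M where "M = Max ((\<lambda>q'. Scov Y N q' q') ` B)"
  define R where "R = (\<Sum>r\<in>C. Scov Y N q q + 2 * Scov Y N q r + Scov Y N r r)"
  define T where "T = (\<Sum>r\<in>C. Scov Y N r r)"
  define W where "W = (\<Sum>r\<in>C. \<Sum>s\<in>C. Scov Y N r s)"
  note B = group_props[OF P grp_props(1)[OF P q], folded B_def]
  have qB: "q \<in> B" unfolding B_def by (rule grp_props(2)[OF P q])
  have b: "b \<ge> 2" using B by (simp add: b_def)
  have cC: "real (card C) = b - 1" using B qB by (simp add: C_def b_def of_nat_diff)
  have posB: "\<forall>r\<in>B. Scov Y N r r > 0" using pos B(1) by auto
  have le_M: "Scov Y N r r \<le> M" if "r \<in> B" for r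
    unfolding M_def using B(2) that by (intro Max_ge) auto
  have M: "M > 0" using le_M[OF qB] posB qB by force
  have Th: "Theta P Y N q = mu N B / b^2 * ((b - 1) * R + (rho Y N B * T - W))"
    unfolding Theta_def Let_def B_def[symmetric] b_def R_def T_def W_def C_def ..
  have R0: "0 \<le> R" unfolding R_def using N by (intro sum_nonneg Scov_pair_nonneg) auto
  have "R \<le> (\<Sum>r\<in>C. 4 * M)"
    unfolding R_def
  proof (rule sum_mono)
    fix r assume "r \<in> C"
    then show "Scov Y N q q + 2 * Scov Y N q r + Scov Y N r r \<le> 4 * M"
      using Scov_pair_nonneg(2)[of N Y q r] N le_M[OF qB] le_M[of r] by (simp add: C_def)
  qed
  then have R4: "R \<le> (b - 1) * (4 * M)" using cC by simp
  have WT: "W \<le> rho Y N B * T"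
    unfolding W_def T_def C_def using B qB posB by (intro rho_dominates_Scov) auto
  have W0: "0 \<le> W" unfolding W_def using quad_form_Scov_nonneg[of N "\<lambda>_. 1" Y C] N by simp
  have T0: "0 \<le> T" unfolding T_def using posB by (intro sum_nonneg) (auto simp: C_def less_imp_le)
  have "T \<le> (\<Sum>r\<in>C. M)" unfolding T_def by (intro sum_mono le_M) (auto simp: C_def)
  then have TM: "T \<le> (b - 1) * M" using cC by simp
  have rb: "rho Y N B \<le> b" unfolding b_def using B qB N by (intro rho_le_card) auto
  have mu0: "0 \<le> mu N B" using N by (rule mu_nonneg)
  show "0 \<le> Theta P Y N q" unfolding Th using mu0 R0 WT b by simp
  have "(b - 1) * R \<le> (b - 1) * ((b - 1) * (4 * M))" using R4 b by (intro mult_left_mono) auto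
  also have "\<dots> \<le> b * (b * (4 * M))" using b M by (intro mult_mono) auto
  finally have 1: "(b - 1) * R \<le> 4 * M * b^2" by (simp add: power2_eq_square mult_ac)
  have "rho Y N B * T \<le> b * T" using rb T0 by (rule mult_right_mono)
  also have "\<dots> \<le> b * (b * M)" using TM b M by (intro mult_left_mono) (auto simp: algebra_simps)
  finally have 2: "rho Y N B * T \<le> M * b^2" by (simp add: power2_eq_square mult_ac)
  have "Theta P Y N q \<le> mu N B / b^2 * (5 * M * b^2)"
    unfolding Th using 1 2 W0 mu0 by (intro mult_left_mono) (auto simp: algebra_simps)
  also have "\<dots> = 5 * mu N B * M" using b by simp
  finally show "Theta P Y N q \<le> 5 * mu N (grp P q) * Max ((\<lambda>q'. Scov Y N q' q') ` grp P q)"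
    unfolding B_def M_def .
qed

lemma Eperm_Vhat_diagonal:
  assumes N: "N > 2" and P: "is_grouping N P" and q: "q < N"
  shows "Eperm N (\<lambda>\<sigma>. Vhat P Y N \<sigma> q q) = Scov Y N q q + Omega P Y N q
    + mu N (grp P q) * (Ybar Y N q - Ybar_grp Y N (grp P q))^2 + Theta P Y N q / real N"
proof -
  define B where "B = grp P q"
  define b where "b = real (card B)"
  define C where "C = B - {q}"
  define \<beta> where "\<beta> = Ybar Y N q - Ybar_grp Y N B"
  define T where "T = (\<Sum>r\<in>C. Scov Y N r r)"
  define U where "U = (\<Sum>r\<in>C. Scov Y N q r)"
  define W where "W = (\<Sum>r\<in>C. \<Sum>s\<in>C. Scov Y N r s)"
  define S where "S = Scov Y N q q"
  define m where "m = mu N B"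
  define \<rho> where "\<rho> = rho Y N B"
  note B = group_props[OF P grp_props(1)[OF P q], folded B_def]
  have qB: "q \<in> B" unfolding B_def by (rule grp_props(2)[OF P q])
  have b: "b \<ge> 2" using B by (simp add: b_def)
  have cC: "real (card C) = b - 1" using B qB by (simp add: C_def b_def of_nat_diff)
  have "Eperm N (\<lambda>\<sigma>. Vhat P Y N \<sigma> q q)
      = m * (\<beta>^2 + (\<Sum>r\<in>B. \<Sum>s\<in>B. ((if r = q then 1 else 0) - 1 / b) * ((if s = q then 1 else 0) - 1 / b) * VY Y N r s))"
    unfolding Vhat_def if_P[OF refl] B_def[symmetric] group_residual_eq[OF B(2) qB, where N = N] Eperm_cmult
      b_def m_def \<beta>_def using B N by (subst Eperm_affine_squared) auto
  also have "\<dots> = m * (\<beta>^2 + ((1 - 1 / b)^2 * S + T / b^2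
      - ((1 - 1 / b)^2 * S - 2 * (1 - 1 / b) / b * U + W / b^2) / real N))"
    unfolding b_def centering_variance[OF B(2) qB] S_def T_def U_def W_def C_def ..
  also have "\<dots> = S + m / b^2 * (1 - \<rho> / real N - (b - 1) / real N) * T + m * \<beta>^2
      + (m / b^2 * ((b - 1) * ((b - 1) * S + 2 * U + T) + (\<rho> * T - W))) / real N"
  proof -
    \<comment> \<open>In terms of the reciprocals \<open>v\<close> and \<open>x\<close> the claim is
      a polynomial identity modulo \<open>bv\<close> and \<open>key\<close>.\<close>
    define v where "v = 1 / b"
    define x where "x = 1 / real N"
    have bv: "(b - 1) * v = 1 - v" using b by (simp add: v_def field_simps)
    have "1 - 2 * x > 0" "1 - v > 0" using N b by (auto simp: x_def v_def)
    moreover have "m = inverse (1 - 2 * x) * inverse ((1 - v)^2)"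
      unfolding m_def mu_def b_def[symmetric] by (simp add: v_def x_def)
    moreover have "inverse e * inverse f * f * e = 1" if "e > 0" "f > 0" for e f :: real
      using that by (simp add: field_simps)
    ultimately have "m * (1 - v)^2 * (1 - 2 * x) = 1" by simp
    \<comment> \<open>The normalisation in \<open>mu\<close> makes the factor 1. Of the two
      \<open>x\<close> in \<open>1 - 2 * x\<close>, one matches the term \<open>- S / N\<close> of
      the covariance; the other is surplus and enters \<open>Theta\<close>.\<close>
    then have key: "S = m * (1 - v)^2 * (1 - 2 * x) * S" by simp
    have div_b: "a / b = a * v" and div_b2: "a / b^2 = a * v^2" and div_N: "a / real N = a * x" for a
      by (simp_all add: v_def x_def power_one_over)
    show ?thesis unfolding div_b2 div_b div_N mult_1 using key bv by algebra
  qed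
  also have "(b - 1) * S + 2 * U + T = (\<Sum>r\<in>C. Scov Y N q q + 2 * Scov Y N q r + Scov Y N r r)"
    unfolding S_def U_def T_def using cC by (simp add: sum.distrib sum_distrib_left)
  finally show ?thesis
    unfolding Theta_def Omega_def Let_def B_def[symmetric] b_def C_def T_def W_def S_def m_def \<rho>_def \<beta>_def
    by simp
qed

text \<open>On the diagonal the added \<open>S / N\<close> cancels the one subtracted in
  \<open>VY\<close>. Off the diagonal \<open>Vhat\<close> is 0 and \<open>VY\<close> is exactly
  \<open>- S / N\<close>.\<close>

lemma Eperm_Vhat:
  assumes "N > 2" "is_grouping N P" "q < N" "q' < N"
  shows "Eperm N (\<lambda>\<sigma>. Vhat P Y N \<sigma> q q') =
    VY Y N q q' + (if q = q' then Omega P Y N q else 0)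
    + (if q = q' then mu N (grp P q) * (Ybar Y N q - Ybar_grp Y N (grp P q))^2 else 0)
    + ((if q = q' then Theta P Y N q else 0) + Scov Y N q q') / real N"
proof (cases "q = q'")
  case True
  then show ?thesis
    using Eperm_Vhat_diagonal[OF assms(1-3)] by (simp add: VY_def add_divide_distrib)
next
  case False
  then show ?thesis by (simp add: Vhat_def VY_def Eperm_const)
qed

lemma Omega_nonneg:
  assumes N: "N > 2" and P: "is_grouping N P" and pos: "\<forall>q<N. Scov Y N q q > 0"
    and c5: "condition5 P Y N" and q: "q < N"
  shows "0 \<le> Omega P Y N q"
proof -
  note G = grp_props[OF P q]
  note B = group_props[OF P G(1)]
  have "real N - rho Y N (grp P q) - (real (card (grp P q)) - 1) \<ge> 0"
    using c5 G(1) unfolding condition5_def by blast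
  then have "0 \<le> (real N - rho Y N (grp P q) - (real (card (grp P q)) - 1)) / real N" by simp
  also have "\<dots> = 1 - rho Y N (grp P q) / real N - (real (card (grp P q)) - 1) / real N"
    using N by (simp add: diff_divide_distrib)
  finally show ?thesis
    unfolding Omega_def Let_def using mu_nonneg[OF N] pos B(1)
    by (intro mult_nonneg_nonneg divide_nonneg_nonneg sum_nonneg) (auto intro: less_imp_le)
qed

section \<open>Conservativeness of the estimator\<close>

lemma Eperm_sandwich:
  "Eperm N (\<lambda>\<sigma>. sandwich Q F (A \<sigma>) h h') = sandwich Q F (\<lambda>q q'. Eperm N (\<lambda>\<sigma>. A \<sigma> q q')) h h'"
proof -
  have "Eperm N (\<lambda>\<sigma>. F q h * A \<sigma> q q' * F q' h') = F q h * Eperm N (\<lambda>\<sigma>. A \<sigma> q q') * F q' h'" for q q'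
    using Eperm_cmult[of N "F q h * F q' h'" "\<lambda>\<sigma>. A \<sigma> q q'"] by (simp add: mult_ac)
  then show ?thesis unfolding sandwich_def Eperm_sum by simp
qed

text \<open>With \<open>z = F x\<close> the form of \<open>sandwich Q F D\<close> at
  \<open>x\<close> is the form of \<open>D\<close> at \<open>z\<close>; the chain of equations only
  exchanges the four sums.\<close>

lemma psd_sandwich:
  assumes "psd Q D"
  shows "psd H (sandwich Q F D)"
  unfolding psd_def
proof
  fix x :: "nat \<Rightarrow> real"
  define z where "z q = (\<Sum>h<H. x h * F q h)" for q
  have "(\<Sum>h<H. \<Sum>h'<H. x h * sandwich Q F D h h' * x h')
      = (\<Sum>h<H. \<Sum>h'<H. \<Sum>q<Q. \<Sum>q'<Q. x h * F q h * D q q' * (x h' * F q' h'))"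
    unfolding sandwich_def sum_distrib_left sum_distrib_right by (simp add: mult_ac)
  also have "\<dots> = (\<Sum>h<H. \<Sum>q<Q. \<Sum>h'<H. \<Sum>q'<Q. x h * F q h * D q q' * (x h' * F q' h'))"
    by (intro sum.cong refl sum.swap)
  also have "\<dots> = (\<Sum>q<Q. \<Sum>h<H. \<Sum>h'<H. \<Sum>q'<Q. x h * F q h * D q q' * (x h' * F q' h'))"
    by (rule sum.swap)
  also have "\<dots> = (\<Sum>q<Q. \<Sum>h<H. \<Sum>q'<Q. \<Sum>h'<H. x h * F q h * D q q' * (x h' * F q' h'))"
    by (intro sum.cong refl sum.swap)
  also have "\<dots> = (\<Sum>q<Q. \<Sum>q'<Q. \<Sum>h<H. \<Sum>h'<H. x h * F q h * D q q' * (x h' * F q' h'))"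
    by (intro sum.cong refl sum.swap)
  also have "\<dots> = (\<Sum>q<Q. \<Sum>q'<Q. z q * D q q' * z q')"
    unfolding z_def sum_distrib_left sum_distrib_right by (intro sum.cong refl sum.swap)
  finally show "0 \<le> (\<Sum>h<H. \<Sum>h'<H. x h * sandwich Q F D h h' * x h')"
    using assms unfolding psd_def by simp
qed

text \<open>The excess of the mean over \<open>VY\<close> is a nonnegative diagonal matrix plus the
  positive semidefinite \<open>S / N\<close>. Condition 5 enters through the sign of
  \<open>Omega\<close>.\<close>

lemma psd_Eperm_sandwich_Vhat:
  assumes N: "N > 2" and P: "is_grouping N P" and pos: "\<forall>q<N. Scov Y N q q > 0"
    and c5: "condition5 P Y N"
  shows "psd H (\<lambda>h h'. Eperm N (\<lambda>\<sigma>. sandwich N F (Vhat P Y N \<sigma>) h h') - Vgamma F Y N h h')"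
proof -
  define D where "D q q' = Eperm N (\<lambda>\<sigma>. Vhat P Y N \<sigma> q q') - VY Y N q q'" for q q'
  define d where "d q = Omega P Y N q + mu N (grp P q) * (Ybar Y N q - Ybar_grp Y N (grp P q))^2
      + Theta P Y N q / real N" for q
  have D: "D q q' = (if q = q' then d q else 0) + Scov Y N q q' / real N" if "q < N" "q' < N" for q q'
    unfolding D_def d_def Eperm_Vhat[OF N P that] by (simp add: add_divide_distrib)
  have d: "0 \<le> d q" if "q < N" for q
    unfolding d_def using that Omega_nonneg[OF N P pos c5] mu_nonneg[OF N] Theta_bounds(1)[OF N P pos]
    by (intro add_nonneg_nonneg mult_nonneg_nonneg divide_nonneg_nonneg) auto
  have "psd N D"
    unfolding psd_def
  proof
    fix x :: "nat \<Rightarrow> real"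
    have "(\<Sum>i<N. \<Sum>j<N. x i * D i j * x j)
        = (\<Sum>i<N. (\<Sum>j<N. if i = j then x i * d i * x i else 0) + (\<Sum>j<N. x i * Scov Y N i j * x j) / real N)"
      unfolding sum_divide_distrib sum.distrib[symmetric]
      by (intro sum.cong refl) (auto simp: D algebra_simps)
    also have "\<dots> = (\<Sum>i<N. x i * d i * x i) + (\<Sum>i<N. \<Sum>j<N. x i * Scov Y N i j * x j) / real N"
      by (simp add: sum.distrib sum_divide_distrib)
    also have "\<dots> \<ge> 0"
    proof (rule add_nonneg_nonneg)
      have "0 \<le> d i * (x i)^2" if "i < N" for i using d that by simp
      then show "0 \<le> (\<Sum>i<N. x i * d i * x i)"
        by (intro sum_nonneg) (simp add: power2_eq_square mult_ac)
      show "0 \<le> (\<Sum>i<N. \<Sum>j<N. x i * Scov Y N i j * x j) / real N"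
        using N quad_form_Scov_nonneg[of N x Y "{..<N}"] by simp
    qed
    finally show "0 \<le> (\<Sum>i<N. \<Sum>j<N. x i * D i j * x j)" .
  qed
  moreover have "sandwich N F D h h' = Eperm N (\<lambda>\<sigma>. sandwich N F (Vhat P Y N \<sigma>) h h') - Vgamma F Y N h h'" for h h'
    unfolding Eperm_sandwich Vgamma_def
    unfolding sandwich_def D_def by (simp add: algebra_simps sum_subtractf)
  ultimately show ?thesis using psd_sandwich[of N D H F] by (simp add: fun_eq_iff psd_def)
qed

subsection \<open>Fluctuations of the variance estimator\<close>

text \<open>Position \<open>k\<close> and level \<open>q\<close> are kept apart because, after an
  exchange, a level receives the unit of another position.\<close>

lemma Eperm_dev_pow4:
  assumes "condition3 Y N \<Delta>" "k < N" "q < N"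
  shows "Eperm N (\<lambda>\<sigma>. (dev Y N (\<sigma> k) q)^4) \<le> \<Delta>^4"
  using assms Eperm_marginal[of k N "\<lambda>i. (dev Y N i q)^4"] by (simp add: condition3_def dev_def)

lemma Eperm_dev_sq:
  assumes "condition3 Y N \<Delta>" "k < N" "q < N"
  shows "Eperm N (\<lambda>\<sigma>. (dev Y N (\<sigma> k) q)^2) \<le> \<Delta>^2"
proof (rule power2_le_imp_le)
  have "(Eperm N (\<lambda>\<sigma>. (dev Y N (\<sigma> k) q)^2))^2 \<le> Eperm N (\<lambda>\<sigma>. ((dev Y N (\<sigma> k) q)^2)^2)"
    by (rule Eperm_squared_le)
  also have "\<dots> \<le> (\<Delta>^2)^2" using Eperm_dev_pow4[OF assms] by simp
  finally show "(Eperm N (\<lambda>\<sigma>. (dev Y N (\<sigma> k) q)^2))^2 \<le> (\<Delta>^2)^2" .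
qed simp

text \<open>The inequality of arithmetic and geometric means reduces the mixed moment to two
  marginal fourth moments, whether or not the positions coincide.\<close>

lemma Eperm_dev_sq_sq:
  assumes "condition3 Y N \<Delta>" "k < N" "q < N" "l < N" "r < N"
  shows "Eperm N (\<lambda>\<sigma>. (dev Y N (\<sigma> k) q)^2 * (dev Y N (\<sigma> l) r)^2) \<le> \<Delta>^4"
proof -
  have *: "a^2 * b^2 \<le> (a^4 + b^4) / 2" for a b :: real
    using sum_squares_bound[of "a^2" "b^2"] by simp
  have "Eperm N (\<lambda>\<sigma>. (dev Y N (\<sigma> k) q)^2 * (dev Y N (\<sigma> l) r)^2)
      \<le> Eperm N (\<lambda>\<sigma>. ((dev Y N (\<sigma> k) q)^4 + (dev Y N (\<sigma> l) r)^4) / 2)"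
    by (intro Eperm_mono *)
  also have "\<dots> \<le> (\<Delta>^4 + \<Delta>^4) / 2"
    unfolding Eperm_cdiv Eperm_add using assms
    by (intro divide_right_mono add_mono Eperm_dev_pow4) auto
  finally show ?thesis by simp
qed

text \<open>The argument \<open>s\<close> need not be a permutation: exchanging two units passes through an assignment that
  uses one unit twice.\<close>

definition weighted_residuals ::
  "nat set set \<Rightarrow> (nat \<Rightarrow> nat \<Rightarrow> real) \<Rightarrow> nat \<Rightarrow> (nat \<Rightarrow> real) \<Rightarrow> (nat \<Rightarrow> nat) \<Rightarrow> real" where
  "weighted_residuals P Y N c s = (\<Sum>q<N. c q * (Yobs Y s q - Yhat_grp Y s (grp P q))^2)"

text \<open>Changing the outcome of \<open>p\<close> by \<open>\<delta>\<close> shifts the residual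
  of \<open>p\<close> by \<open>\<delta> * (1 - 1 / b)\<close>, those of the rest of its group by
  \<open>- \<delta> / b\<close>, and no others. Differences of squares factor into shift times
  \<open>t\<close>, and Cauchy-Schwarz gives a bound with no growth in the group size.\<close>

lemma weighted_residuals_update:
  fixes Y :: "nat \<Rightarrow> nat \<Rightarrow> real" and s :: "nat \<Rightarrow> nat" and j :: nat
  assumes P: "is_grouping N P" and p: "p < N" and c: "\<forall>q<N. \<bar>c q\<bar> \<le> K" and K: "0 \<le> K"
  defines "B \<equiv> grp P p"
  defines "t \<equiv> \<lambda>q. (Yobs Y (s(p := j)) q - Yhat_grp Y (s(p := j)) B) + (Yobs Y s q - Yhat_grp Y s B)"
  shows "(weighted_residuals P Y N c (s(p := j)) - weighted_residuals P Y N c s)^2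
    \<le> 2 * K^2 * (Y j p - Y (s p) p)^2 * ((t p)^2 + (\<Sum>q\<in>B. (t q)^2) / real (card B))"
proof -
  define s' where "s' = s(p := j)"
  define x where "x u q = Yobs Y u q - Yhat_grp Y u (grp P q)" for u q
  define b where "b = real (card B)"
  define \<delta> where "\<delta> = Y j p - Y (s p) p"
  \<comment> \<open>Dominates the size of the shift coefficients. Its total over \<open>B\<close> is
    1 + 1, whence the constant 2 when it serves as the weight in Cauchy-Schwarz.\<close>
  define g where "g q = (if q = p then 1 else 0) + 1 / b" for q
  have BP: "B \<in> P" and pB: "p \<in> B" unfolding B_def using grp_props[OF P p] by auto
  note B = group_props[OF P BP]
  have b: "b \<ge> 2" using B(3) by (simp add: b_def)
  have gB: "grp P q = B" if "q \<in> B" for q using grp_eqI[OF P BP that] .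
  have same: "x s' q = x s q" if "q < N" "q \<notin> B" for q
  proof -
    have "q \<in> grp P q" "grp P q \<in> P" using grp_props[OF P that(1)] by auto
    then have "p \<notin> grp P q" using that gB grp_eqI[OF P _, of "grp P q" p] B_def by metis
    moreover have "q \<noteq> p" using that pB by auto
    ultimately show ?thesis
      unfolding x_def Yobs_def Yhat_grp_def s'_def by (auto intro!: sum.cong)
  qed
  have t: "t q = x s' q + x s q" if "q \<in> B" for q
    unfolding t_def x_def s'_def using gB[OF that] by simp
  have diff: "x s' q - x s q = \<delta> * ((if q = p then 1 else 0) - 1 / b)" if "q \<in> B" for q
  proof -
    have Y: "Yobs Y s' r = Yobs Y s r + (if r = p then \<delta> else 0)" for r
      by (simp add: Yobs_def s'_def \<delta>_def)
    have "Yhat_grp Y s' B = Yhat_grp Y s B + \<delta> / b"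
      unfolding Yhat_grp_def Y using B(2) pB by (simp add: sum.distrib add_divide_distrib b_def)
    then show ?thesis unfolding x_def gB[OF that] Y by (simp add: algebra_simps)
  qed
  have "weighted_residuals P Y N c s' - weighted_residuals P Y N c s
      = (\<Sum>q<N. c q * ((x s' q)^2 - (x s q)^2))"
    unfolding weighted_residuals_def x_def sum_subtractf[symmetric] by (simp add: algebra_simps)
  also have "\<dots> = (\<Sum>q\<in>B. c q * ((x s' q)^2 - (x s q)^2))"
    using B(1) same by (intro sum.mono_neutral_right) auto
  finally have "\<bar>weighted_residuals P Y N c s' - weighted_residuals P Y N c s\<bar>
      = \<bar>\<Sum>q\<in>B. c q * ((x s' q)^2 - (x s q)^2)\<bar>" by simp
  also have "\<dots> \<le> (\<Sum>q\<in>B. K * \<bar>\<delta>\<bar> * (g q * \<bar>t q\<bar>))"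
  proof (rule sum_abs[THEN order_trans], rule sum_mono)
    fix q assume q: "q \<in> B"
    have "\<bar>c q * ((x s' q)^2 - (x s q)^2)\<bar> = \<bar>c q\<bar> * (\<bar>x s' q - x s q\<bar> * \<bar>t q\<bar>)"
      unfolding t[OF q] abs_mult[symmetric] by (simp add: power2_eq_square algebra_simps)
    also have "\<dots> \<le> K * ((\<bar>\<delta>\<bar> * g q) * \<bar>t q\<bar>)"
    proof (intro mult_mono)
      show "\<bar>c q\<bar> \<le> K" using c q B(1) by auto
      have "\<bar>(if q = p then 1 else 0) - 1 / b\<bar> \<le> g q" using b by (auto simp: g_def)
      then show "\<bar>x s' q - x s q\<bar> \<le> \<bar>\<delta>\<bar> * g q"
        unfolding diff[OF q] abs_mult by (intro mult_left_mono) auto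
      show "0 \<le> \<bar>\<delta>\<bar> * g q" using b by (simp add: g_def)
    qed (use K in auto)
    finally show "\<bar>c q * ((x s' q)^2 - (x s q)^2)\<bar> \<le> K * \<bar>\<delta>\<bar> * (g q * \<bar>t q\<bar>)" by (simp add: mult_ac)
  qed
  also have "\<dots> = K * \<bar>\<delta>\<bar> * (\<Sum>q\<in>B. g q * \<bar>t q\<bar>)" by (simp add: sum_distrib_left)
  finally have "\<bar>weighted_residuals P Y N c s' - weighted_residuals P Y N c s\<bar>^2
      \<le> (K * \<bar>\<delta>\<bar> * (\<Sum>q\<in>B. g q * \<bar>t q\<bar>))^2"
    by (intro power_mono) auto
  also have "\<dots> = K^2 * \<delta>^2 * (\<Sum>q\<in>B. g q * \<bar>t q\<bar>)^2" by (simp add: power_mult_distrib)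
  also have "\<dots> \<le> K^2 * \<delta>^2 * (2 * ((t p)^2 + (\<Sum>q\<in>B. (t q)^2) / b))"
  proof (intro mult_left_mono)
    have g0: "0 \<le> g q" for q using b by (simp add: g_def)
    have "(\<Sum>q\<in>B. g q * \<bar>t q\<bar>)^2 = (\<Sum>q\<in>B. sqrt (g q) * (sqrt (g q) * \<bar>t q\<bar>))^2"
      by (simp add: mult.assoc[symmetric] g0)
    also have "\<dots> \<le> (\<Sum>q\<in>B. (sqrt (g q))^2) * (\<Sum>q\<in>B. (sqrt (g q) * \<bar>t q\<bar>)^2)"
      by (rule Cauchy_Schwarz_ineq_sum)
    also have "(\<Sum>q\<in>B. (sqrt (g q))^2) = 2"
      using B(2) pB b unfolding g0[THEN real_sqrt_pow2] g_def
      by (simp add: sum.distrib b_def[symmetric])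
    also have "(\<Sum>q\<in>B. (sqrt (g q) * \<bar>t q\<bar>)^2) = (\<Sum>q\<in>B. (if q = p then (t q)^2 else 0) + (t q)^2 / b)"
      unfolding power_mult_distrib g0[THEN real_sqrt_pow2]
      by (intro sum.cong refl) (simp add: g_def algebra_simps)
    also have "\<dots> = (t p)^2 + (\<Sum>q\<in>B. (t q)^2) / b"
      using B(2) pB by (simp add: sum.distrib sum_divide_distrib)
    finally show "(\<Sum>q\<in>B. g q * \<bar>t q\<bar>)^2 \<le> 2 * ((t p)^2 + (\<Sum>q\<in>B. (t q)^2) / b)" .
  qed simp
  finally show ?thesis unfolding s'_def \<delta>_def b_def by (simp add: algebra_simps)
qed

text \<open>Here \<open>\<pi>\<close> tells each level which position of \<open>\<sigma>\<close> to
  read, so it need not be injective. The squared outcome change is at most twice the sum of two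
  \<open>e\<close> terms and the residual factor at most \<open>6 * w\<close>; the constant is 384 =
  24 * (8 + 8).\<close>

lemma Eperm_weighted_residuals_update:
  assumes P: "is_grouping N P" and c: "\<forall>q<N. \<bar>c q\<bar> \<le> K" and K: "0 \<le> K"
    and c3: "condition3 Y N \<Delta>" and c6: "condition6 P Y N \<zeta>"
    and p: "p < N" and k: "k < N" and \<pi>: "\<And>q. q < N \<Longrightarrow> \<pi> q < N"
  shows "Eperm N (\<lambda>\<sigma>. (weighted_residuals P Y N c (\<sigma> \<circ> \<pi>(p := k)) - weighted_residuals P Y N c (\<sigma> \<circ> \<pi>))^2)
    \<le> 384 * K^2 * (\<Delta>^2 * (\<Delta>^2 + \<zeta>^2))"
proof -
  define B where "B = grp P p"
  define b where "b = real (card B)"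
  define \<pi>' where "\<pi>' = \<pi>(p := k)"
  define m where "m u \<sigma> = (\<Sum>r\<in>B. (dev Y N (\<sigma> (u r)) r)^2) / b" for u \<sigma> :: "nat \<Rightarrow> nat"
  define e where "e i \<sigma> = (dev Y N (\<sigma> i) p)^2" for i :: nat and \<sigma> :: "nat \<Rightarrow> nat"
  \<comment> \<open>One sixth of the bounds for \<open>(t p)^2\<close> and for the group mean of
    \<open>(t q)^2\<close> together: the first supplies \<open>2 * \<zeta>^2\<close>, both
    \<open>e\<close> terms and one copy of each \<open>m\<close>, the second
    \<open>2 * \<zeta>^2\<close> and two copies of each \<open>m\<close>.\<close>
  define w where "w \<sigma> = 4 * \<zeta>^2 + e (\<pi> p) \<sigma> + e k \<sigma> + 3 * m \<pi> \<sigma> + 3 * m \<pi>' \<sigma>" for \<sigma>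
  have BP: "B \<in> P" and pB: "p \<in> B" unfolding B_def using grp_props[OF P p] by auto
  note B = group_props[OF P BP]
  have b: "b \<ge> 2" using B(3) by (simp add: b_def)
  have Bne: "B \<noteq> {}" using pB by auto
  have \<pi>': "\<pi>' q < N" if "q < N" for q using that \<pi> k by (simp add: \<pi>'_def)
  define x where "x s q = Yobs Y s q - Yhat_grp Y s B" for s q
  have sq3: "(y1 + y2 - y3)^2 \<le> 3 * (y1^2 + y2^2 + y3^2)" for y1 y2 y3 :: real
    using sum_squares_bound[of y1 y2] sum_squares_bound[of y1 "- y3"] sum_squares_bound[of y2 "- y3"]
    by (simp add: power2_eq_square algebra_simps)
  have x: "(x (\<sigma> \<circ> u) q)^2 \<le> 3 * (\<zeta>^2 + (dev Y N (\<sigma> (u q)) q)^2 + m u \<sigma>)" if q: "q \<in> B" for u \<sigma> q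
  proof -
    have "\<bar>Ybar Y N q - Ybar_grp Y N B\<bar> \<le> \<zeta>" using c6 BP q unfolding condition6_def by blast
    then have "(Ybar Y N q - Ybar_grp Y N B)^2 \<le> \<zeta>^2" by (rule abs_le_square_iff[THEN iffD1, OF order_trans]) simp
    moreover have "((\<Sum>r\<in>B. dev Y N (\<sigma> (u r)) r) / b)^2 \<le> m u \<sigma>"
      unfolding m_def b_def by (rule mean_squared_le[OF B(2) Bne])
    ultimately show ?thesis
      unfolding x_def group_residual_dev[where N = N] b_def[symmetric]
      using sq3[of "Ybar Y N q - Ybar_grp Y N B" "dev Y N (\<sigma> (u q)) q" "(\<Sum>r\<in>B. dev Y N (\<sigma> (u r)) r) / b"]
      by simp
  qed
  have pointwise: "(weighted_residuals P Y N c (\<sigma> \<circ> \<pi>') - weighted_residuals P Y N c (\<sigma> \<circ> \<pi>))^2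
      \<le> 24 * K^2 * ((e k \<sigma> + e (\<pi> p) \<sigma>) * w \<sigma>)" for \<sigma>
  proof -
    define t where "t q = x (\<sigma> \<circ> \<pi>') q + x (\<sigma> \<circ> \<pi>) q" for q
    have t: "(t q)^2 \<le> 6 * (2 * \<zeta>^2 + (dev Y N (\<sigma> (\<pi>' q)) q)^2 + (dev Y N (\<sigma> (\<pi> q)) q)^2 + m \<pi>' \<sigma> + m \<pi> \<sigma>)"
      if "q \<in> B" for q
      using x[OF that, of \<sigma> \<pi>'] x[OF that, of \<sigma> \<pi>] sum_squares_bound[of "x (\<sigma> \<circ> \<pi>') q" "x (\<sigma> \<circ> \<pi>) q"]
      unfolding t_def power2_sum by (simp add: algebra_simps)
    \<comment> \<open>Averaging over \<open>B\<close> turns the individual squared deviations into a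
      further copy of \<open>m\<close>, hence the factor 2 at each \<open>m\<close> below.\<close>
    have "(\<Sum>q\<in>B. (t q)^2) / b \<le> (\<Sum>q\<in>B. 6 * (2 * \<zeta>^2 + (dev Y N (\<sigma> (\<pi>' q)) q)^2
        + (dev Y N (\<sigma> (\<pi> q)) q)^2 + m \<pi>' \<sigma> + m \<pi> \<sigma>)) / b"
      using b by (intro divide_right_mono sum_mono t) auto
    also have "\<dots> = 6 * (b * (2 * \<zeta>^2) + (\<Sum>q\<in>B. (dev Y N (\<sigma> (\<pi>' q)) q)^2)
        + (\<Sum>q\<in>B. (dev Y N (\<sigma> (\<pi> q)) q)^2) + b * m \<pi>' \<sigma> + b * m \<pi> \<sigma>) / b"
      unfolding sum_distrib_left[symmetric] sum.distrib b_def by simp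
    also have "\<dots> = 6 * (2 * \<zeta>^2 + 2 * m \<pi>' \<sigma> + 2 * m \<pi> \<sigma>)"
      unfolding m_def using b by (simp add: field_simps)
    finally have mean_t: "(\<Sum>q\<in>B. (t q)^2) / b \<le> 6 * (2 * \<zeta>^2 + 2 * m \<pi>' \<sigma> + 2 * m \<pi> \<sigma>)" .
    have tp: "(t p)^2 \<le> 6 * (2 * \<zeta>^2 + e k \<sigma> + e (\<pi> p) \<sigma> + m \<pi>' \<sigma> + m \<pi> \<sigma>)"
      using t[OF pB] by (simp add: e_def \<pi>'_def)
    have "(Y (\<sigma> k) p - Y ((\<sigma> \<circ> \<pi>) p) p)^2 = (dev Y N (\<sigma> k) p - dev Y N (\<sigma> (\<pi> p)) p)^2"
      by (simp add: dev_def)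
    also have "\<dots> \<le> 2 * (e k \<sigma> + e (\<pi> p) \<sigma>)"
      using sum_squares_bound[of "dev Y N (\<sigma> k) p" "- dev Y N (\<sigma> (\<pi> p)) p"]
      by (simp add: e_def power2_diff)
    finally have \<delta>: "(Y (\<sigma> k) p - Y ((\<sigma> \<circ> \<pi>) p) p)^2 \<le> 2 * (e k \<sigma> + e (\<pi> p) \<sigma>)" .
    have upd: "\<sigma> \<circ> \<pi>' = (\<sigma> \<circ> \<pi>)(p := \<sigma> k)" by (auto simp: \<pi>'_def)
    have "(weighted_residuals P Y N c (\<sigma> \<circ> \<pi>') - weighted_residuals P Y N c (\<sigma> \<circ> \<pi>))^2
      \<le> 2 * K^2 * (Y (\<sigma> k) p - Y ((\<sigma> \<circ> \<pi>) p) p)^2 * ((t p)^2 + (\<Sum>q\<in>B. (t q)^2) / b)"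
      using weighted_residuals_update[OF P p c K, of Y "\<sigma> \<circ> \<pi>" "\<sigma> k"]
      unfolding t_def x_def upd B_def b_def by simp
    also have "\<dots> \<le> 2 * K^2 * (2 * (e k \<sigma> + e (\<pi> p) \<sigma>)) * (6 * w \<sigma>)"
    proof (intro mult_mono mult_left_mono \<delta>)
      show "(t p)^2 + (\<Sum>q\<in>B. (t q)^2) / b \<le> 6 * w \<sigma>"
        using tp mean_t unfolding w_def by (simp add: algebra_simps)
      show "0 \<le> (t p)^2 + (\<Sum>q\<in>B. (t q)^2) / b"
        using b by (intro add_nonneg_nonneg divide_nonneg_nonneg sum_nonneg) auto
    qed (auto simp: e_def)
    finally show ?thesis by (simp add: algebra_simps)
  qed
  \<comment> \<open>The 8 is 1 + 1 + 3 + 3, counting the fourth-moment terms of \<open>w\<close>;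
    the coefficient 4 of the \<open>\<zeta>^2\<close> term is enlarged to 8 so that the sum
    factors.\<close>
  have Ew: "Eperm N (\<lambda>\<sigma>. e i \<sigma> * w \<sigma>) \<le> 8 * (\<Delta>^2 * (\<Delta>^2 + \<zeta>^2))" if i: "i < N" for i
  proof -
    have Em: "Eperm N (\<lambda>\<sigma>. e i \<sigma> * m u \<sigma>) \<le> \<Delta>^4" if u: "\<And>q. q < N \<Longrightarrow> u q < N" for u
    proof -
      have "Eperm N (\<lambda>\<sigma>. e i \<sigma> * m u \<sigma>) = (\<Sum>r\<in>B. Eperm N (\<lambda>\<sigma>. (dev Y N (\<sigma> i) p)^2 * (dev Y N (\<sigma> (u r)) r)^2)) / b"
        unfolding e_def m_def times_divide_eq_right sum_distrib_left Eperm_cdiv Eperm_sum ..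
      also have "\<dots> \<le> (\<Sum>r\<in>B. \<Delta>^4) / b"
        using b B(1) i p u by (intro divide_right_mono sum_mono Eperm_dev_sq_sq[OF c3]) auto
      also have "\<dots> = \<Delta>^4" using b by (simp add: b_def)
      finally show ?thesis .
    qed
    have Ee: "Eperm N (\<lambda>\<sigma>. e i \<sigma> * e l \<sigma>) \<le> \<Delta>^4" if "l < N" for l
      unfolding e_def using i p that by (intro Eperm_dev_sq_sq[OF c3])
    have "Eperm N (\<lambda>\<sigma>. e i \<sigma> * w \<sigma>) = 4 * \<zeta>^2 * Eperm N (e i) + Eperm N (\<lambda>\<sigma>. e i \<sigma> * e (\<pi> p) \<sigma>)
        + Eperm N (\<lambda>\<sigma>. e i \<sigma> * e k \<sigma>) + 3 * Eperm N (\<lambda>\<sigma>. e i \<sigma> * m \<pi> \<sigma>) + 3 * Eperm N (\<lambda>\<sigma>. e i \<sigma> * m \<pi>' \<sigma>)"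
      unfolding w_def Eperm_cmult[symmetric] Eperm_add[symmetric] by (simp add: algebra_simps)
    also have "\<dots> \<le> 4 * \<zeta>^2 * \<Delta>^2 + \<Delta>^4 + \<Delta>^4 + 3 * \<Delta>^4 + 3 * \<Delta>^4"
    proof (intro add_mono mult_left_mono)
      show "Eperm N (e i) \<le> \<Delta>^2" unfolding e_def using c3 i p by (rule Eperm_dev_sq)
    qed (use Ee Em \<pi> \<pi>' p k in auto)
    also have "\<dots> = 8 * (\<Delta>^2 * \<Delta>^2) + 4 * (\<Delta>^2 * \<zeta>^2)"
      by (simp add: power2_eq_square power4_eq_xxxx)
    also have "\<dots> \<le> 8 * (\<Delta>^2 * \<Delta>^2) + 8 * (\<Delta>^2 * \<zeta>^2)" by simp
    finally show ?thesis by (simp add: distrib_left)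
  qed
  have "Eperm N (\<lambda>\<sigma>. (weighted_residuals P Y N c (\<sigma> \<circ> \<pi>') - weighted_residuals P Y N c (\<sigma> \<circ> \<pi>))^2)
      \<le> Eperm N (\<lambda>\<sigma>. 24 * K^2 * ((e k \<sigma> + e (\<pi> p) \<sigma>) * w \<sigma>))"
    by (intro Eperm_mono pointwise)
  also have "\<dots> = 24 * K^2 * (Eperm N (\<lambda>\<sigma>. e k \<sigma> * w \<sigma>) + Eperm N (\<lambda>\<sigma>. e (\<pi> p) \<sigma> * w \<sigma>))"
    unfolding Eperm_cmult distrib_right Eperm_add ..
  also have "\<dots> \<le> 24 * K^2 * (8 * (\<Delta>^2 * (\<Delta>^2 + \<zeta>^2)) + 8 * (\<Delta>^2 * (\<Delta>^2 + \<zeta>^2)))"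
    using \<pi>[OF p] k by (intro mult_left_mono add_mono Ew) auto
  finally show ?thesis unfolding \<pi>'_def by simp
qed

lemma Eperm_variance_weighted_residuals:
  assumes P: "is_grouping N P" and c: "\<forall>q<N. \<bar>c q\<bar> \<le> K" and K: "0 \<le> K"
    and c3: "condition3 Y N \<Delta>" and c6: "condition6 P Y N \<zeta>"
  defines "f \<equiv> weighted_residuals P Y N c"
  shows "Eperm N (\<lambda>\<sigma>. (f \<sigma> - Eperm N f)^2) \<le> 1536 * (K^2 * (\<Delta>^2 * (\<Delta>^2 + \<zeta>^2)) * real N)"
proof -
  define V where "V = 384 * K^2 * (\<Delta>^2 * (\<Delta>^2 + \<zeta>^2))"
  note upd = Eperm_weighted_residuals_update[OF P c K c3 c6, folded f_def V_def]
  have "Eperm N (\<lambda>\<sigma>. (f (\<sigma> \<circ> Transposition.transpose k j) - f \<sigma>)^2) \<le> 4 * V"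
    if kj: "k < N" "j < N" for k j
  proof -
    \<comment> \<open>An exchange is two single changes. Between them levels \<open>k\<close> and
      \<open>j\<close> both read position \<open>j\<close>; squaring the sum of the two changes
      costs the factor 4 = 2 + 2, whence 1536 = 4 * 384.\<close>
    have tr: "Transposition.transpose k j = (id(k := j))(j := k)"
      by (auto simp: Transposition.transpose_def)
    have "(f (\<sigma> \<circ> Transposition.transpose k j) - f \<sigma>)^2
        \<le> 2 * (f (\<sigma> \<circ> (id(k := j))(j := k)) - f (\<sigma> \<circ> id(k := j)))^2 + 2 * (f (\<sigma> \<circ> id(k := j)) - f (\<sigma> \<circ> id))^2" for \<sigma>
    proof -
      have "(a - c)^2 \<le> 2 * (a - b)^2 + 2 * (b - c)^2" for a b c :: real
        using sum_squares_bound[of "a - b" "b - c"] by (simp add: power2_eq_square algebra_simps)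
      then show ?thesis unfolding tr by simp
    qed
    then have "Eperm N (\<lambda>\<sigma>. (f (\<sigma> \<circ> Transposition.transpose k j) - f \<sigma>)^2)
        \<le> Eperm N (\<lambda>\<sigma>. 2 * (f (\<sigma> \<circ> (id(k := j))(j := k)) - f (\<sigma> \<circ> id(k := j)))^2
            + 2 * (f (\<sigma> \<circ> id(k := j)) - f (\<sigma> \<circ> id))^2)"
      by (intro Eperm_mono)
    also have "\<dots> \<le> 2 * V + 2 * V"
      unfolding Eperm_add Eperm_cmult using kj
      by (intro add_mono mult_left_mono upd) auto
    finally show ?thesis by simp
  qed
  then have "Eperm N (\<lambda>\<sigma>. (f \<sigma> - Eperm N f)^2) \<le> real N * (4 * V)"
    by (rule Eperm_variance_le)
  then show ?thesis by (simp add: V_def algebra_simps)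
qed

section \<open>Reduction to entries and the Frobenius norm\<close>

lemma sandwich_Vhat:
  "sandwich N F (Vhat P Y N \<sigma>) h h' = weighted_residuals P Y N (\<lambda>q. F q h * F q h' * mu N (grp P q)) \<sigma>"
  unfolding sandwich_def weighted_residuals_def
proof (intro sum.cong refl)
  fix q assume "q \<in> {..<N}"
  have "(\<Sum>q'<N. F q h * Vhat P Y N \<sigma> q q' * F q' h')
      = (\<Sum>q'<N. if q = q' then F q h * F q h' * mu N (grp P q) * (Yobs Y \<sigma> q - Yhat_grp Y \<sigma> (grp P q))^2 else 0)"
    by (intro sum.cong refl) (simp add: Vhat_def mult_ac)
  then show "(\<Sum>q'<N. F q h * Vhat P Y N \<sigma> q q' * F q' h')
      = F q h * F q h' * mu N (grp P q) * (Yobs Y \<sigma> q - Yhat_grp Y \<sigma> (grp P q))^2"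
    using \<open>q \<in> {..<N}\<close> by simp
qed

lemma finite_maxnorm_set: "finite (insert 0 {\<bar>A i j\<bar> | i j. i < m \<and> j < (n::nat)})"
  for A :: "nat \<Rightarrow> nat \<Rightarrow> real" and m :: nat
proof -
  have "finite {\<bar>A i j\<bar> | i j. i \<in> {..<m} \<and> j \<in> {..<n}}" by (intro finite_image_set2) auto
  then show ?thesis by simp
qed

lemma abs_le_maxnorm: "i < m \<Longrightarrow> j < n \<Longrightarrow> \<bar>A i j\<bar> \<le> maxnorm m n A"
  unfolding maxnorm_def by (intro Max_ge finite_maxnorm_set) auto

lemma maxnorm_nonneg: "0 \<le> maxnorm m n A"
  unfolding maxnorm_def by (intro Max_ge finite_maxnorm_set) auto

lemma maxnorm_sq_le: "(maxnorm m n A)^2 \<le> (\<Sum>i<m. \<Sum>j<n. (A i j)^2)"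
proof -
  have "maxnorm m n A \<in> insert 0 {\<bar>A i j\<bar> | i j. i < m \<and> j < n}"
    unfolding maxnorm_def by (intro Max_in finite_maxnorm_set) auto
  then consider "maxnorm m n A = 0" | i j where "maxnorm m n A = \<bar>A i j\<bar>" "i < m" "j < n" by auto
  then show ?thesis
  proof cases
    case 1
    then show ?thesis by (simp add: sum_nonneg)
  next
    case 2
    have "(A i j)^2 \<le> (\<Sum>j<n. (A i j)^2)" using 2 by (intro member_le_sum) auto
    also have "\<dots> \<le> (\<Sum>i<m. \<Sum>j<n. (A i j)^2)"
      using 2 member_le_sum[of i "{..<m}" "\<lambda>i. \<Sum>j<n. (A i j)^2"] by (simp add: sum_nonneg)
    finally show ?thesis using 2 by simp
  qed
qed

text \<open>Cauchy-Schwarz in each row bounds every member of the set by the Frobenius norm. The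
  same bound makes the \<open>Sup\<close> well defined, and the inserted 0 makes it nonnegative even
  without unit vectors.\<close>

lemma opnorm_sq_le: "(opnorm m n A)^2 \<le> (\<Sum>i<m. \<Sum>j<n. (A i j)^2)"
proof -
  let ?X = "insert 0 {sqrt (\<Sum>i<m. (\<Sum>j<n. A i j * x j)^2) | x. (\<Sum>j<n. (x j)^2) = 1}"
  define Fr where "Fr = sqrt (\<Sum>i<m. \<Sum>j<n. (A i j)^2)"
  have Fr2: "Fr^2 = (\<Sum>i<m. \<Sum>j<n. (A i j)^2)" and Fr0: "0 \<le> Fr"
    unfolding Fr_def by (simp_all add: sum_nonneg)
  have le: "y \<le> Fr" if "y \<in> ?X" for y
  proof -
    have "sqrt (\<Sum>i<m. (\<Sum>j<n. A i j * x j)^2) \<le> Fr" if x: "(\<Sum>j<n. (x j)^2) = 1" for x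
      unfolding Fr_def
    proof (intro real_sqrt_le_mono sum_mono)
      fix i
      show "(\<Sum>j<n. A i j * x j)^2 \<le> (\<Sum>j<n. (A i j)^2)"
        using Cauchy_Schwarz_ineq_sum[of "A i" x "{..<n}"] x by simp
    qed
    then show ?thesis using that Fr0 by auto
  qed
  have "opnorm m n A \<le> Fr" unfolding opnorm_def by (rule cSup_least) (use le in auto)
  moreover have "0 \<le> opnorm m n A"
    unfolding opnorm_def by (rule cSup_upper) (use le in \<open>auto intro!: bdd_aboveI[of _ Fr]\<close>)
  ultimately show ?thesis unfolding Fr2[symmetric] by (intro power_mono)
qed

text \<open>Each entry is a weighted residual sum with weights at most \<open>K\<close>, so its
  variance is at most \<open>1536 * base\<close>; the \<open>H\<close> squared entries give the
  remaining factor.\<close>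

lemma Eperm_frobenius_deviation:
  fixes F :: "nat \<Rightarrow> nat \<Rightarrow> real" and H :: nat
  assumes N: "N > 2" and P: "is_grouping N P"
    and c3: "condition3 Y N \<Delta>" and c6: "condition6 P Y N \<zeta>"
  defines "D \<equiv> \<lambda>\<sigma> h h'. sandwich N F (Vhat P Y N \<sigma>) h h' - Eperm N (\<lambda>\<tau>. sandwich N F (Vhat P Y N \<tau>) h h')"
  defines "base \<equiv> (Max (mu N ` P))^2 * (maxnorm N H F)^4 * \<Delta>^2 * (\<Delta>^2 + \<zeta>^2) * real N"
  shows "Eperm N (\<lambda>\<sigma>. \<Sum>h<H. \<Sum>h'<H. (D \<sigma> h h')^2) \<le> 1536 * (base * real H ^ 2)"
proof -
  define K where "K = (maxnorm N H F)^2 * Max (mu N ` P)"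
  have "P \<subseteq> Pow {..<N}" using group_props(1)[OF P] by auto
  then have finP: "finite P" by (rule finite_subset) simp
  have muM: "0 \<le> mu N (grp P q) \<and> mu N (grp P q) \<le> Max (mu N ` P)" if "q < N" for q
    using mu_nonneg[OF N] finP grp_props(1)[OF P that] by auto
  have Max0: "0 \<le> Max (mu N ` P)" using muM[of 0] N by force
  have K: "0 \<le> K" unfolding K_def using Max0 by simp
  have "Eperm N (\<lambda>\<sigma>. (D \<sigma> h h')^2) \<le> 1536 * base" if h: "h < H" "h' < H" for h h'
  proof -
    define c where "c q = F q h * F q h' * mu N (grp P q)" for q
    have "\<bar>c q\<bar> \<le> K" if "q < N" for q
      unfolding c_def K_def abs_mult power2_eq_square
      using muM[OF that] h that abs_le_maxnorm[of q N _ H F] maxnorm_nonneg[of N H F]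
      by (intro mult_mono) auto
    then have "\<forall>q<N. \<bar>c q\<bar> \<le> K" by blast
    from Eperm_variance_weighted_residuals[OF P this K c3 c6]
    show ?thesis
      unfolding D_def sandwich_Vhat c_def[symmetric] base_def K_def
      by (simp add: power_mult_distrib power2_eq_square power4_eq_xxxx mult_ac)
  qed
  then have "(\<Sum>h<H. \<Sum>h'<H. Eperm N (\<lambda>\<sigma>. (D \<sigma> h h')^2)) \<le> (\<Sum>h<H. \<Sum>h'<H. 1536 * base)"
    by (intro sum_mono) auto
  then show ?thesis
    unfolding Eperm_sum by (simp add: power2_eq_square mult_ac)
qed

theorem theorem6:
  shows
  "(\<forall>(N::nat) (Y::nat \<Rightarrow> nat \<Rightarrow> real) (P::nat set set).
      N > 2 \<and> is_grouping N P \<and> (\<forall>q<N. Scov Y N q q > 0) \<and> condition5 P Y N \<longrightarrow>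
      (\<exists>\<Theta>::nat \<Rightarrow> real.
         (\<forall>q<N. 0 \<le> \<Theta> q \<and>
                 \<Theta> q \<le> 5 * mu N (grp P q) * Max ((\<lambda>q'. Scov Y N q' q') ` grp P q)) \<and>
         (\<forall>q<N. \<forall>q'<N.
            Eperm N (\<lambda>\<sigma>. Vhat P Y N \<sigma> q q') =
              VY Y N q q'
              + (if q = q' then Omega P Y N q else 0)
              + (if q = q' then mu N (grp P q) * (Ybar Y N q - Ybar_grp Y N (grp P q))^2 else 0)
              + ((if q = q' then \<Theta> q else 0) + Scov Y N q q') / real N))
      \<and> (\<forall>(H::nat) (F::nat \<Rightarrow> nat \<Rightarrow> real).
           psd H (\<lambda>h h'. Eperm N (\<lambda>\<sigma>. sandwich N F (Vhat P Y N \<sigma>) h h') - Vgamma F Y N h h')))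
   \<and>
   (\<forall>(Y::nat \<Rightarrow> nat \<Rightarrow> nat \<Rightarrow> real) (P::nat \<Rightarrow> nat set set)
      (F::nat \<Rightarrow> nat \<Rightarrow> nat \<Rightarrow> real) (H::nat \<Rightarrow> nat) (\<Delta>::nat \<Rightarrow> real) (\<zeta>::nat \<Rightarrow> real).
      (\<forall>\<^sub>F N in sequentially.
          is_grouping N (P N) \<and> (\<forall>q<N. Scov (Y N) N q q > 0) \<and>
          condition3 (Y N) N (\<Delta> N) \<and> condition6 (P N) (Y N) N (\<zeta> N)) \<longrightarrow>
      (let Dev = (\<lambda>N \<sigma> h h'. sandwich N (F N) (Vhat (P N) (Y N) N \<sigma>) h h'
                       - Eperm N (\<lambda>\<tau>. sandwich N (F N) (Vhat (P N) (Y N) N \<tau>) h h'));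
           base = (\<lambda>N. (Max (mu N ` P N))^2 * (maxnorm N (H N) (F N))^4
                       * (\<Delta> N)^2 * ((\<Delta> N)^2 + (\<zeta> N)^2) * real N)
       in bigOP (\<lambda>N \<sigma>. (maxnorm (H N) (H N) (Dev N \<sigma>))^2) (\<lambda>N. base N * real (H N)^2)
        \<and> bigOP (\<lambda>N \<sigma>. (opnorm (H N) (H N) (Dev N \<sigma>))^2) (\<lambda>N. base N * real (H N)^4)))"
proof (intro conjI allI impI)
  fix N :: nat and Y :: "nat \<Rightarrow> nat \<Rightarrow> real" and P :: "nat set set"
  assume "N > 2 \<and> is_grouping N P \<and> (\<forall>q<N. Scov Y N q q > 0) \<and> condition5 P Y N"
  then have N: "N > 2" and P: "is_grouping N P" and pos: "\<forall>q<N. Scov Y N q q > 0"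
    and c5: "condition5 P Y N" by auto
  show "\<exists>\<Theta>. (\<forall>q<N. 0 \<le> \<Theta> q \<and>
                 \<Theta> q \<le> 5 * mu N (grp P q) * Max ((\<lambda>q'. Scov Y N q' q') ` grp P q)) \<and>
         (\<forall>q<N. \<forall>q'<N.
            Eperm N (\<lambda>\<sigma>. Vhat P Y N \<sigma> q q') =
              VY Y N q q'
              + (if q = q' then Omega P Y N q else 0)
              + (if q = q' then mu N (grp P q) * (Ybar Y N q - Ybar_grp Y N (grp P q))^2 else 0)
              + ((if q = q' then \<Theta> q else 0) + Scov Y N q q') / real N)"
    by (intro exI[of _ "Theta P Y N"] conjI allI impI Theta_bounds[OF N P pos] Eperm_Vhat[OF N P])
  show "psd H (\<lambda>h h'. Eperm N (\<lambda>\<sigma>. sandwich N F (Vhat P Y N \<sigma>) h h') - Vgamma F Y N h h')" for H F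
    by (rule psd_Eperm_sandwich_Vhat[OF N P pos c5])
next
  fix Y :: "nat \<Rightarrow> nat \<Rightarrow> nat \<Rightarrow> real" and P :: "nat \<Rightarrow> nat set set"
    and F :: "nat \<Rightarrow> nat \<Rightarrow> nat \<Rightarrow> real" and H :: "nat \<Rightarrow> nat" and \<Delta> \<zeta> :: "nat \<Rightarrow> real"
  assume ev: "\<forall>\<^sub>F N in sequentially.
          is_grouping N (P N) \<and> (\<forall>q<N. Scov (Y N) N q q > 0) \<and>
          condition3 (Y N) N (\<Delta> N) \<and> condition6 (P N) (Y N) N (\<zeta> N)"
  define D where "D = (\<lambda>N \<sigma> h h'. sandwich N (F N) (Vhat (P N) (Y N) N \<sigma>) h h'
                       - Eperm N (\<lambda>\<tau>. sandwich N (F N) (Vhat (P N) (Y N) N \<tau>) h h'))"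
  define base where "base = (\<lambda>N. (Max (mu N ` P N))^2 * (maxnorm N (H N) (F N))^4
                       * (\<Delta> N)^2 * ((\<Delta> N)^2 + (\<zeta> N)^2) * real N)"
  define Fr where "Fr N \<sigma> = (\<Sum>h<H N. \<Sum>h'<H N. (D N \<sigma> h h')^2)" for N \<sigma>
  have base0: "0 \<le> base N" for N unfolding base_def by simp
  have Fr: "\<forall>\<^sub>F N in sequentially. Eperm N (Fr N) \<le> 1536 * (base N * real (H N)^2)"
    \<comment> \<open>The entrywise bound requires \<open>N > 2\<close>, which holds
      eventually.\<close>
    using ev eventually_gt_at_top[of 2]
  proof eventually_elim
    case (elim N)
    then show ?case unfolding Fr_def D_def base_def by (intro Eperm_frobenius_deviation) auto
  qed
  \<comment> \<open>One Frobenius bound of order \<open>H\<close> squared serves both norms; for the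
    operator norm it is relaxed to the fourth power, with \<open>H N = 0\<close> treated apart
    because powers increase only from base 1 on.\<close>
  have bound: "bigOP X (\<lambda>N. base N * real (H N)^k)"
    if X: "\<And>N \<sigma>. 0 \<le> X N \<sigma>" "\<And>N \<sigma>. X N \<sigma> \<le> Fr N \<sigma>" and k: "k \<ge> 2" for X k
  proof (rule bigOP_of_mean_bound[where C = 1536])
    show "\<forall>\<^sub>F N in sequentially. 0 \<le> base N * real (H N)^k \<and> Eperm N (X N) \<le> 1536 * (base N * real (H N)^k)"
      using Fr
    proof eventually_elim
      case (elim N)
      have "real (H N)^2 \<le> real (H N)^k"
      proof (cases "H N = 0")
        case False
        then show ?thesis using k by (intro power_increasing) auto
      qed (use k in auto)
      then have "base N * real (H N)^2 \<le> base N * real (H N)^k"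
        using base0 by (rule mult_left_mono)
      moreover have "Eperm N (X N) \<le> Eperm N (Fr N)" by (intro Eperm_mono X)
      ultimately show ?case using elim base0[of N] by auto
    qed
  qed (use X in auto)
  have "bigOP (\<lambda>N \<sigma>. (maxnorm (H N) (H N) (D N \<sigma>))^2) (\<lambda>N. base N * real (H N)^2)"
    by (rule bound) (auto simp: Fr_def maxnorm_sq_le)
  moreover have "bigOP (\<lambda>N \<sigma>. (opnorm (H N) (H N) (D N \<sigma>))^2) (\<lambda>N. base N * real (H N)^4)"
    by (rule bound) (auto simp: Fr_def opnorm_sq_le)
  ultimately show "let Dev = (\<lambda>N \<sigma> h h'. sandwich N (F N) (Vhat (P N) (Y N) N \<sigma>) h h'
                       - Eperm N (\<lambda>\<tau>. sandwich N (F N) (Vhat (P N) (Y N) N \<tau>) h h'));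
           base = (\<lambda>N. (Max (mu N ` P N))^2 * (maxnorm N (H N) (F N))^4
                       * (\<Delta> N)^2 * ((\<Delta> N)^2 + (\<zeta> N)^2) * real N)
       in bigOP (\<lambda>N \<sigma>. (maxnorm (H N) (H N) (Dev N \<sigma>))^2) (\<lambda>N. base N * real (H N)^2)
        \<and> bigOP (\<lambda>N \<sigma>. (opnorm (H N) (H N) (Dev N \<sigma>))^2) (\<lambda>N. base N * real (H N)^4)"
    unfolding Let_def D_def base_def by blast
qed

end
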